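(* Let $\theta\in(0,1)$ and let $\eta,\xi\in\mathcal F_\theta(E^\infty,\mathbb R)$ with $\xi\ge0$. Suppose there exists a unique $\delta\in\mathbb R$ with $P(\eta-\delta\xi)=0$, and let $t^*=\sup\{t\in\mathbb R:\eta+t\xi\text{ is summable}\}$. If $-\delta<t^*$ and $\int-(\eta+t\xi)\,d\mu_{\eta-\delta\xi}<\infty$ for all $t$ in an open neighbourhood of $-\delta$, then for each $\chi\in\mathcal F_\theta^b(E^\infty,\mathbb R)$ and each $x\in E^\infty$, the residue of $z\mapsto(\mathrm{Id}-\mathcal L_{\eta+z\xi})^{-1}\chi(x)$ at the simple pole $z=-\delta$ is equal to $$-\frac{\int\chi\,d\nu_{\eta-\delta\xi}}{\int\xi\,d\mu_{\eta-\delta\xi}}\,h_{\eta-\delta\xi}(x).$$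
   Context: Let $I\subset\mathbb N$ be an at most countable alphabet, $A\colon I\times I\to\{0,1\}$ an incidence matrix, $E^\infty=\{\omega\in I^{\mathbb N}: A_{\omega_j\omega_{j+1}}=1\ \forall j\ge 1\}$ with the subspace topology of the product of discrete topologies, $E^n$ the set of subwords of length $n$ of elements of $E^\infty$, $E^*=\bigcup_{n\ge0}E^n$ ($E^0$ contains only the empty word). Standing assumption: $A$ is finitely irreducible, i.e. there is a finite set $\Lambda\subset E^*$ such that for all $i,j\in I$ there is $\omega\in\Lambda$ with $i\omega j\in E^*$. $\sigma$ is the left shift on $E^\infty$; $[\omega]$ is the cylinder set of $\omega\in E^n$; $\omega|_n$ is the initial subword of length $n$; $S_nf=\sum_{j=0}^{n-1}f\circ\sigma^j$. The pressure of $u\colon E^\infty\to\mathbb R$ is $P(u)=\lim_{n\to\infty}\frac1n\log\sum_{\omega\in E^n}\exp(\sup_{\tau\in[\omega]}S_nu(\tau))$. For continuous $f\colon E^\infty\to\mathbb C$, $\mathrm{var}_n(f)=\sup\{|f(x)-f(y)|: x_i=y_i\text{ for }i\le n\}$ and $\|f\|_\theta=\sup_{n\ge1}\mathrm{var}_n(f)/\theta^n$. $\mathcal F_\theta(E^\infty,\mathbb R)$: real continuous functions with $\|f\|_\theta<\infty$ (possibly unbounded); $\mathcal F_\theta^b(E^\infty,\mathbb R)$: the bounded ones; $\mathcal F_\theta^b(E^\infty)$: bounded continuous complex functions with $\|f\|_\theta<\infty$, a Banach space under $\|\cdot\|_\theta+\|\cdot\|_\infty$. A real-valued $u\in\mathcal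 F_\theta(E^\infty,\mathbb R)$ is summable if $\sum_{e\in I}\exp(\sup(u|_{[e]}))<\infty$. For $f=u+\mathbf{i}v$ with $u,v\in\mathcal F_\theta(E^\infty,\mathbb R)$ and $u$ summable, $\mathcal L_f(g)(\omega)=\sum_{y:\sigma y=\omega}e^{f(y)}g(y)$ is a bounded operator on $\mathcal F_\theta^b(E^\infty)$. For summable $u$, $\nu_u$ is the unique Borel probability measure with $\mathcal L_u^*\nu_u=e^{P(u)}\nu_u$; $h_u$ is the positive bounded eigenfunction in $\mathcal F_\theta^b(E^\infty)$ with $\mathcal L_uh_u=e^{P(u)}h_u$, $\int h_u\,d\nu_u=1$; $\mu_u$ is the unique ergodic $\sigma$-invariant Gibbs state for $u$, where a Borel probability measure $\mu$ is a Gibbs state for $u$ if there is $c>0$ with $c^{-1}\le\mu([\omega|_n])/\exp(S_nu(\omega)-nP(u))\le c$ for all $\omega\in E^\infty$, $n\in\mathbb N$. The resolvent map $z\mapsto(\mathrm{Id}-\mathcal L_{\eta+z\xi})^{-1}\in\mathcal B(\mathcal F_\theta^b(E^\infty))$ (bounded linear operators on $\mathcal F_\theta^b(E^\infty)$) is holomorphic on $\mathrm{Re}(z)<-\delta$ and, when $-\delta<t^*$, extends meromorphically to a neighbourhood of $-\delta$ with a simple pole at $-\delta$. *)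

theory Defs
  imports "HOL-Probability.Probability" "HOL-Complex_Analysis.Complex_Analysis"
begin

text \<open>
  Sequences are indexed from 0 instead of 1. The type \<^typ>\<open>nat \<Rightarrow> nat\<close> carries the
  product of the discrete topologies. The incidence matrix is a relation, \<open>A i j\<close> standing for
  \<open>A\<^sub>i\<^sub>j = 1\<close>; only its values on \<open>I \<times> I\<close> matter.
\<close>

definition shift_space :: "nat set \<Rightarrow> (nat \<Rightarrow> nat \<Rightarrow> bool) \<Rightarrow> (nat \<Rightarrow> nat) set" where
  "shift_space I A = {\<omega>. (\<forall>n. \<omega> n \<in> I) \<and> (\<forall>n. A (\<omega> n) (\<omega> (Suc n)))}"

definition shift :: "(nat \<Rightarrow> nat) \<Rightarrow> (nat \<Rightarrow> nat)" where
  "shift \<omega> = (\<lambda>n. \<omega> (Suc n))"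

definition words :: "(nat \<Rightarrow> nat) set \<Rightarrow> nat \<Rightarrow> nat list set" where
  "words E n = {map \<tau> [k..<k + n] | \<tau> k. \<tau> \<in> E}"

definition all_words :: "(nat \<Rightarrow> nat) set \<Rightarrow> nat list set" where
  "all_words E = (\<Union>n. words E n)"

definition finitely_irreducible :: "nat set \<Rightarrow> (nat \<Rightarrow> nat \<Rightarrow> bool) \<Rightarrow> bool" where
  "finitely_irreducible I A \<longleftrightarrow>
    (\<exists>\<Lambda>. finite \<Lambda> \<and> \<Lambda> \<subseteq> all_words (shift_space I A) \<and>
      (\<forall>i\<in>I. \<forall>j\<in>I. \<exists>\<omega>\<in>\<Lambda>. i # \<omega> @ [j] \<in> all_words (shift_space I A)))"

definition cylinder :: "(nat \<Rightarrow> nat) set \<Rightarrow> nat list \<Rightarrow> (nat \<Rightarrow> nat) set" where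
  "cylinder E w = {\<tau> \<in> E. map \<tau> [0..<length w] = w}"

definition birkhoff_sum :: "nat \<Rightarrow> ((nat \<Rightarrow> nat) \<Rightarrow> real) \<Rightarrow> (nat \<Rightarrow> nat) \<Rightarrow> real" where
  "birkhoff_sum n u \<omega> = (\<Sum>j<n. u ((shift ^^ j) \<omega>))"

definition exp_ereal :: "ereal \<Rightarrow> ennreal" where
  "exp_ereal x = (if x = -\<infinity> then 0 else if x = \<infinity> then \<infinity> else ennreal (exp (real_of_ereal x)))"

definition ln_ennreal :: "ennreal \<Rightarrow> ereal" where
  "ln_ennreal x = (if x = 0 then -\<infinity> else if x = \<infinity> then \<infinity> else ereal (ln (enn2real x)))"

definition pressure :: "(nat \<Rightarrow> nat) set \<Rightarrow> ((nat \<Rightarrow> nat) \<Rightarrow> real) \<Rightarrow> ereal" where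
  "pressure E u = lim (\<lambda>n. ln_ennreal
     (\<Sum>\<^sub>\<infinity>w\<in>words E n. exp_ereal (SUP \<tau>\<in>cylinder E w. ereal (birkhoff_sum n u \<tau>))) / ereal (real n))"


subsection \<open>Function spaces\<close>

definition variation ::
  "(nat \<Rightarrow> nat) set \<Rightarrow> nat \<Rightarrow> ((nat \<Rightarrow> nat) \<Rightarrow> 'a::real_normed_vector) \<Rightarrow> ennreal" where
  "variation E n f =
    (SUP (x, y)\<in>{(x, y). x \<in> E \<and> y \<in> E \<and> (\<forall>i<n. x i = y i)}. ennreal (norm (f x - f y)))"

definition holder_seminorm ::
  "(nat \<Rightarrow> nat) set \<Rightarrow> real \<Rightarrow> ((nat \<Rightarrow> nat) \<Rightarrow> 'a::real_normed_vector) \<Rightarrow> ennreal" where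
  "holder_seminorm E \<theta> f = (SUP n\<in>{1..}. variation E n f / ennreal (\<theta> ^ n))"

text \<open>
  A function on \<open>E\<close> is represented by its extension by zero to \<^typ>\<open>nat \<Rightarrow> nat\<close>, so that functions
  on \<open>E\<close> are equal iff their representatives are.
\<close>

definition holder_space ::
  "(nat \<Rightarrow> nat) set \<Rightarrow> real \<Rightarrow> ((nat \<Rightarrow> nat) \<Rightarrow> 'a::real_normed_vector) set" where
  "holder_space E \<theta> =
    {f. continuous_on E f \<and> holder_seminorm E \<theta> f < \<infinity> \<and> (\<forall>x. x \<notin> E \<longrightarrow> f x = 0)}"

definition bdd_holder_space ::
  "(nat \<Rightarrow> nat) set \<Rightarrow> real \<Rightarrow> ((nat \<Rightarrow> nat) \<Rightarrow> 'a::real_normed_vector) set" where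
  "bdd_holder_space E \<theta> = {f \<in> holder_space E \<theta>. bounded (f ` E)}"

definition holder_norm ::
  "(nat \<Rightarrow> nat) set \<Rightarrow> real \<Rightarrow> ((nat \<Rightarrow> nat) \<Rightarrow> 'a::real_normed_vector) \<Rightarrow> real" where
  "holder_norm E \<theta> f = enn2real (holder_seminorm E \<theta> f) + (SUP x\<in>E. norm (f x))"

definition summable_potential ::
  "nat set \<Rightarrow> (nat \<Rightarrow> nat) set \<Rightarrow> ((nat \<Rightarrow> nat) \<Rightarrow> real) \<Rightarrow> bool" where
  "summable_potential I E u \<longleftrightarrow>
    (\<Sum>\<^sub>\<infinity>e\<in>I. exp_ereal (SUP \<tau>\<in>cylinder E [e]. ereal (u \<tau>))) < \<infinity>"


subsection \<open>Bounded operators on the space of bounded complex functions\<close>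

type_synonym operator = "((nat \<Rightarrow> nat) \<Rightarrow> complex) \<Rightarrow> ((nat \<Rightarrow> nat) \<Rightarrow> complex)"

text \<open>Only the values of an operator on \<^term>\<open>bdd_holder_space E \<theta>\<close> are relevant.\<close>

definition bounded_operators :: "(nat \<Rightarrow> nat) set \<Rightarrow> real \<Rightarrow> operator set" where
  "bounded_operators E \<theta> = {T.
    (\<forall>g\<in>bdd_holder_space E \<theta>. T g \<in> bdd_holder_space E \<theta>) \<and>
    (\<forall>g\<in>bdd_holder_space E \<theta>. \<forall>g'\<in>bdd_holder_space E \<theta>.
       T (\<lambda>x. g x + g' x) = (\<lambda>x. T g x + T g' x)) \<and>
    (\<forall>g\<in>bdd_holder_space E \<theta>. \<forall>c. T (\<lambda>x. c * g x) = (\<lambda>x. c * T g x)) \<and>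
    (\<exists>C. \<forall>g\<in>bdd_holder_space E \<theta>. holder_norm E \<theta> (T g) \<le> C * holder_norm E \<theta> g)}"

definition operator_norm :: "(nat \<Rightarrow> nat) set \<Rightarrow> real \<Rightarrow> operator \<Rightarrow> real" where
  "operator_norm E \<theta> T =
    (SUP g\<in>{g \<in> bdd_holder_space E \<theta>. holder_norm E \<theta> g \<le> 1}. holder_norm E \<theta> (T g))"

definition operator_holomorphic_on ::
  "(nat \<Rightarrow> nat) set \<Rightarrow> real \<Rightarrow> (complex \<Rightarrow> operator) \<Rightarrow> complex set \<Rightarrow> bool" where
  "operator_holomorphic_on E \<theta> R U \<longleftrightarrow>
    (\<forall>z\<in>U. R z \<in> bounded_operators E \<theta>) \<and>
    (\<forall>z\<in>U. \<exists>D\<in>bounded_operators E \<theta>.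
      ((\<lambda>w. operator_norm E \<theta> (\<lambda>g x. (R w g x - R z g x) / (w - z) - D g x)) \<longlongrightarrow> 0)
        (at z within U))"

definition operator_simple_pole ::
  "(nat \<Rightarrow> nat) set \<Rightarrow> real \<Rightarrow> (complex \<Rightarrow> operator) \<Rightarrow> complex \<Rightarrow> bool" where
  "operator_simple_pole E \<theta> R p \<longleftrightarrow>
    (\<exists>U H. open U \<and> p \<in> U \<and> operator_holomorphic_on E \<theta> H U \<and>
      (\<exists>g\<in>bdd_holder_space E \<theta>. H p g \<noteq> (\<lambda>x. 0)) \<and>
      (\<forall>z\<in>U - {p}. \<forall>g\<in>bdd_holder_space E \<theta>. R z g = (\<lambda>x. H z g x / (z - p))))"

text \<open>The sum below is empty, hence zero, for \<open>\<omega> \<notin> E\<close>, in accordance with extension by zero.\<close>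

definition transfer_operator :: "(nat \<Rightarrow> nat) set \<Rightarrow> ((nat \<Rightarrow> nat) \<Rightarrow> complex) \<Rightarrow> operator" where
  "transfer_operator E f g = (\<lambda>\<omega>. \<Sum>\<^sub>\<infinity>y\<in>{y \<in> E. shift y = \<omega>}. exp (f y) * g y)"

definition inverse_of_Id_minus ::
  "(nat \<Rightarrow> nat) set \<Rightarrow> real \<Rightarrow> operator \<Rightarrow> operator \<Rightarrow> bool" where
  "inverse_of_Id_minus E \<theta> L T \<longleftrightarrow> T \<in> bounded_operators E \<theta> \<and>
    (\<forall>g\<in>bdd_holder_space E \<theta>.
      T (\<lambda>x. g x - L g x) = g \<and> (\<lambda>x. T g x - L (T g) x) = g)"

text \<open>
  \<open>R\<close> is the resolvent map \<open>z \<mapsto> (Id - \<L>\<^sub>\<eta>\<^sub>+\<^sub>z\<^sub>\<xi>)\<^sup>-\<^sup>1\<close>, holomorphic on \<open>Re z < p\<close>, together with its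
  meromorphic extension to a neighbourhood of \<open>p\<close>, where it has a simple pole.
\<close>

definition extended_resolvent ::
  "(nat \<Rightarrow> nat) set \<Rightarrow> real \<Rightarrow> ((nat \<Rightarrow> nat) \<Rightarrow> real) \<Rightarrow> ((nat \<Rightarrow> nat) \<Rightarrow> real) \<Rightarrow> real \<Rightarrow>
    (complex \<Rightarrow> operator) \<Rightarrow> bool" where
  "extended_resolvent E \<theta> \<eta> \<xi> p R \<longleftrightarrow>
    (\<forall>z. Re z < p \<longrightarrow>
      inverse_of_Id_minus E \<theta>
        (transfer_operator E (\<lambda>x. complex_of_real (\<eta> x) + z * complex_of_real (\<xi> x))) (R z)) \<and>
    operator_holomorphic_on E \<theta> R {z. Re z < p} \<and>
    operator_simple_pole E \<theta> R (complex_of_real p)"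


subsection \<open>Measures\<close>

definition borel_probability :: "(nat \<Rightarrow> nat) set \<Rightarrow> (nat \<Rightarrow> nat) measure \<Rightarrow> bool" where
  "borel_probability E \<mu> \<longleftrightarrow> prob_space \<mu> \<and> sets \<mu> = sets (restrict_space borel E)"

text \<open>\<open>\<L>\<^sub>u\<^sup>* \<nu> = e\<^sup>P\<^sup>(\<^sup>u\<^sup>) \<nu>\<close>, the measures acting as functionals on \<^term>\<open>bdd_holder_space E \<theta>\<close>.\<close>

definition eigenmeasure ::
  "(nat \<Rightarrow> nat) set \<Rightarrow> real \<Rightarrow> ((nat \<Rightarrow> nat) \<Rightarrow> real) \<Rightarrow> (nat \<Rightarrow> nat) measure \<Rightarrow> bool" where
  "eigenmeasure E \<theta> u \<nu> \<longleftrightarrow> borel_probability E \<nu> \<and>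
    (\<forall>g\<in>bdd_holder_space E \<theta>.
      (\<integral>x. transfer_operator E (\<lambda>y. complex_of_real (u y)) g x \<partial>\<nu>)
        = complex_of_real (exp (real_of_ereal (pressure E u))) * (\<integral>x. g x \<partial>\<nu>))"

definition normalized_eigenfunction ::
  "(nat \<Rightarrow> nat) set \<Rightarrow> real \<Rightarrow> ((nat \<Rightarrow> nat) \<Rightarrow> real) \<Rightarrow> (nat \<Rightarrow> nat) measure \<Rightarrow>
    ((nat \<Rightarrow> nat) \<Rightarrow> real) \<Rightarrow> bool" where
  "normalized_eigenfunction E \<theta> u \<nu> h \<longleftrightarrow>
    h \<in> bdd_holder_space E \<theta> \<and> (\<forall>x\<in>E. h x > 0) \<and>
    transfer_operator E (\<lambda>y. complex_of_real (u y)) (\<lambda>y. complex_of_real (h y))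
      = (\<lambda>x. complex_of_real (exp (real_of_ereal (pressure E u)) * h x)) \<and>
    (\<integral>x. h x \<partial>\<nu>) = 1"

definition gibbs_state ::
  "(nat \<Rightarrow> nat) set \<Rightarrow> ((nat \<Rightarrow> nat) \<Rightarrow> real) \<Rightarrow> (nat \<Rightarrow> nat) measure \<Rightarrow> bool" where
  "gibbs_state E u \<mu> \<longleftrightarrow> borel_probability E \<mu> \<and>
    (\<exists>c>0. \<forall>\<omega>\<in>E. \<forall>n.
      (let q = measure \<mu> (cylinder E (map \<omega> [0..<n]))
                 / exp (birkhoff_sum n u \<omega> - real n * real_of_ereal (pressure E u))
       in inverse c \<le> q \<and> q \<le> c))"

definition shift_invariant :: "(nat \<Rightarrow> nat) measure \<Rightarrow> bool" where
  "shift_invariant \<mu> \<longleftrightarrow> shift \<in> measurable \<mu> \<mu> \<and> distr \<mu> \<mu> shift = \<mu>"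

definition ergodic :: "(nat \<Rightarrow> nat) measure \<Rightarrow> bool" where
  "ergodic \<mu> \<longleftrightarrow>
    (\<forall>B\<in>sets \<mu>. shift -` B \<inter> space \<mu> = B \<longrightarrow> measure \<mu> B = 0 \<or> measure \<mu> B = 1)"

definition ergodic_gibbs_state ::
  "(nat \<Rightarrow> nat) set \<Rightarrow> ((nat \<Rightarrow> nat) \<Rightarrow> real) \<Rightarrow> (nat \<Rightarrow> nat) measure \<Rightarrow> bool" where
  "ergodic_gibbs_state E u \<mu> \<longleftrightarrow> gibbs_state E u \<mu> \<and> shift_invariant \<mu> \<and> ergodic \<mu>"

end

theory Submission
  imports Defs
begin

text \<open>
  Write \<open>p = - \<delta>\<close>, \<open>u = \<eta> + p \<xi>\<close>, \<open>L\<close> for the transfer operator of \<open>u\<close>, and \<open>H z = (z - p) R z\<close> for the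
  regular part of the resolvent, so that the residue at \<open>p\<close> of \<open>R z \<chi> x\<close> is \<open>H p \<chi> x\<close>. The
  proof determines the function \<open>H p g\<close> for every bounded Hoelder function \<open>g\<close>.

  Since \<open>u\<close> has pressure 0, \<open>\<nu>\<close> is fixed by the dual of \<open>L\<close>. For real \<open>z < p\<close> the transfer operator of
  \<open>\<eta> + z \<xi>\<close> is \<open>L\<close> applied after multiplication by \<open>exp (- (p - z) \<xi>)\<close>, a bounded Hoelder function
  because \<open>\<xi>\<close> is nonnegative. Integrating the resolvent equation against \<open>\<nu>\<close> therefore removes the
  transfer operator altogether, and dominated convergence for \<open>z \<rightarrow> p\<close> (lemma \<open>resolvent_limit\<close>) gives
  two facts. The equation multiplied by indicators of cylinders shows that the complex measure
  \<open>(H p g) \<nu>\<close> is shift invariant; divided by \<open>z - p\<close>, it shows that \<open>\<xi> * H p g\<close> and \<open>- g\<close> have the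
  same \<open>\<nu>\<close>-integral.

  It remains to see that invariant measures of this form are multiples of \<open>\<mu>\<close>. The Gibbs property
  of \<open>\<mu>\<close> and an easy upper bound for \<open>\<nu>\<close> on cylinders give \<open>\<nu> \<le> K \<mu>\<close> (lemma \<open>nu_le_mu\<close>), so \<open>\<nu>\<close> has a
  density with respect to \<open>\<mu>\<close>, and an invariant signed measure with a density with respect to an
  ergodic measure is a constant multiple of it (lemma \<open>AE_eq_mean_of_invariant_density\<close>). Applied to
  \<open>(H p g) \<nu>\<close> and to \<open>h \<nu>\<close>, this yields \<open>h \<nu> = \<mu>\<close> and \<open>H p g = c h\<close>, where \<open>c\<close> is the \<open>\<nu>\<close>-integral of
  \<open>H p g\<close>; the equality holds at every point because both sides are continuous and \<open>\<mu>\<close> charges all nonempty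
  cylinders (lemma \<open>invariant_function\<close>). Thus \<open>c\<close> times the \<open>\<mu>\<close>-integral of \<open>\<xi>\<close> is minus the
  \<open>\<nu>\<close>-integral of \<open>g\<close>. Taking \<open>g = 1\<close> shows that the integral of \<open>\<xi>\<close> does not vanish, and \<open>g = \<chi>\<close> is
  the claim.
\<close>

section \<open>Cylinders and Borel measures on sequence space\<close>

lemma mem_cylinder_iff: "\<tau> \<in> cylinder E w \<longleftrightarrow> \<tau> \<in> E \<and> (\<forall>i<length w. \<tau> i = w ! i)"
proof -
  have "map \<tau> [0..<length w] = w \<longleftrightarrow> (\<forall>i<length w. \<tau> i = w ! i)"
    by (subst list_eq_iff_nth_eq) simp
  then show ?thesis by (simp add: cylinder_def)
qed

lemma cylinder_eq_Int: "cylinder E w = E \<inter> cylinder UNIV w"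
  by (auto simp: mem_cylinder_iff)

lemma open_cylinder_UNIV: "open (cylinder UNIV w)"
proof -
  have "cylinder UNIV w = (\<Inter>i\<in>{..<length w}. (\<lambda>\<tau>. \<tau> i) -` {w ! i})"
    by (auto simp: mem_cylinder_iff)
  moreover have "open ((\<lambda>\<tau>. \<tau> i) -` {w ! i})" for i :: nat
    by (rule open_vimage[OF Topological_Spaces.open_discrete continuous_on_product_coordinates])
  ultimately show ?thesis by auto
qed

text \<open>
  A basic open set of the product topology constrains only finitely many coordinates, hence contains
  the cylinder of a sufficiently long initial word of each of its points.
\<close>

lemma open_contains_cylinder:
  fixes U :: "(nat \<Rightarrow> nat) set"
  assumes "open U" "x \<in> U"
  obtains n where "\<And>m. m \<ge> n \<Longrightarrow> cylinder UNIV (map x [0..<m]) \<subseteq> U"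
proof -
  have "openin (product_topology (\<lambda>i. euclidean) UNIV) U"
    using assms(1) by (simp add: open_fun_def)
  from product_topology_open_contains_basis[OF this assms(2)]
  obtain X where X: "x \<in> (\<Pi>\<^sub>E i\<in>UNIV. X i)" "finite {i. X i \<noteq> UNIV}" "(\<Pi>\<^sub>E i\<in>UNIV. X i) \<subseteq> U"
    by auto
  obtain n where n: "\<forall>i\<in>{i. X i \<noteq> UNIV}. i < n"
    using X(2) by (metis finite_nat_bounded lessThan_iff subset_iff)
  have "cylinder UNIV (map x [0..<m]) \<subseteq> U" if "m \<ge> n" for m
  proof
    fix y assume y: "y \<in> cylinder UNIV (map x [0..<m])"
    have "y i \<in> X i" for i
    proof (cases "X i = UNIV")
      case False
      then have "i < m" using n that by force
      then show ?thesis using y X(1) by (auto simp: mem_cylinder_iff PiE_def Pi_def)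
    qed simp
    then show "y \<in> U" using X(3) by (auto simp: PiE_def Pi_def extensional_def)
  qed
  then show ?thesis using that by blast
qed

lemma cylinder_basis: "topological_basis (insert {} (range (cylinder UNIV)))"
proof (rule topological_basisI)
  fix U :: "(nat \<Rightarrow> nat) set" and x assume "open U" "x \<in> U"
  then obtain n where "cylinder UNIV (map x [0..<n]) \<subseteq> U"
    by (metis open_contains_cylinder order_refl)
  moreover have "x \<in> cylinder UNIV (map x [0..<n])"
    by (simp add: mem_cylinder_iff)
  ultimately show "\<exists>B\<in>insert {} (range (cylinder UNIV)). x \<in> B \<and> B \<subseteq> U"
    by blast
qed (auto simp: open_cylinder_UNIV)

lemma borel_eq_sigma_cylinders:
  "(borel :: (nat \<Rightarrow> nat) measure) = sigma UNIV (insert {} (range (cylinder UNIV)))"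
  by (rule borel_eq_countable_basis[OF _ cylinder_basis]) auto

lemma Int_stable_cylinders: "Int_stable (insert {} (range (cylinder UNIV)))"
proof -
  have *: "cylinder UNIV v \<inter> cylinder UNIV w \<in> insert {} (range (cylinder UNIV))"
    if "length v \<le> length w" for v w
  proof (cases "take (length v) w = v")
    case True
    then have "\<forall>i<length v. w ! i = v ! i" using that by (metis nth_take)
    then have "cylinder UNIV v \<inter> cylinder UNIV w = cylinder UNIV w"
      using that by (auto simp: mem_cylinder_iff)
    then show ?thesis by auto
  next
    case False
    moreover have "take (length v) w = v" if "\<forall>i<length v. w ! i = v ! i"
      using that \<open>length v \<le> length w\<close> by (intro nth_equalityI) auto
    ultimately obtain i where "i < length v" "w ! i \<noteq> v ! i"
      by blast
    then have "cylinder UNIV v \<inter> cylinder UNIV w = {}"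
      using that by (auto simp: mem_cylinder_iff)
    then show ?thesis by auto
  qed
  have "cylinder UNIV v \<inter> cylinder UNIV w \<in> insert {} (range (cylinder UNIV))" for v w
    using *[of v w] *[of w v] by (cases "length v \<le> length w") (auto simp: Int_commute)
  then show ?thesis by (auto simp: Int_stable_def)
qed

text \<open>
  An open set is an increasing union of sets each of which is a countable disjoint union of
  cylinders of one fixed length; so a comparison of measures on cylinders passes to open sets.
\<close>

lemma emeasure_le_open_of_cylinders:
  fixes M N :: "(nat \<Rightarrow> nat) measure"
  assumes sets: "sets M = sets borel" "sets N = sets borel"
    and le: "\<And>w. emeasure N (cylinder UNIV w) \<le> C * emeasure M (cylinder UNIV w)"
    and U: "open U"
  shows "emeasure N U \<le> C * emeasure M U"
proof -
  define W where "W n = {w. length w = n \<and> cylinder UNIV w \<subseteq> U}" for n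
  define V where "V n = (\<Union>w\<in>W n. cylinder UNIV w)" for n
  have cyl[measurable]: "cylinder UNIV w \<in> sets borel" for w
    by (rule borel_open[OF open_cylinder_UNIV])
  have cnt: "countable (W n)" for n by simp
  have disj: "disjoint_family_on (cylinder UNIV) (W n)" for n
    by (auto simp: disjoint_family_on_def W_def mem_cylinder_iff list_eq_iff_nth_eq)
  have V_sets: "V n \<in> sets borel" for n
    unfolding V_def by (rule sets.countable_UN'[OF cnt]) auto
  have "V n \<subseteq> V (Suc n)" for n
  proof
    fix y assume "y \<in> V n"
    then obtain w where w: "length w = n" "cylinder UNIV w \<subseteq> U" "y \<in> cylinder UNIV w"
      by (auto simp: V_def W_def)
    have "cylinder UNIV (w @ [y n]) \<subseteq> cylinder UNIV w"
      by (fastforce simp: mem_cylinder_iff nth_append)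
    moreover have "y \<in> cylinder UNIV (w @ [y n])"
      using w by (auto simp: mem_cylinder_iff nth_append less_Suc_eq)
    ultimately have "w @ [y n] \<in> W (Suc n)" "y \<in> cylinder UNIV (w @ [y n])"
      using w by (auto simp: W_def)
    then show "y \<in> V (Suc n)" unfolding V_def by blast
  qed
  then have inc: "incseq V" by (rule incseq_SucI)
  have UV: "U = (\<Union>n. V n)"
  proof
    show "U \<subseteq> (\<Union>n. V n)"
    proof
      fix y assume "y \<in> U"
      then obtain n where "cylinder UNIV (map y [0..<n]) \<subseteq> U"
        using open_contains_cylinder[OF U] by (metis order_refl)
      then have "y \<in> V n"
        by (auto simp: V_def W_def mem_cylinder_iff intro!: exI[of _ "map y [0..<n]"])
      then show "y \<in> (\<Union>n. V n)" by blast
    qed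
  qed (auto simp: V_def W_def)
  have V_le: "emeasure N (V n) \<le> C * emeasure M (V n)" for n
  proof -
    have "emeasure N (V n) = (\<integral>\<^sup>+w. emeasure N (cylinder UNIV w) \<partial>count_space (W n))"
      unfolding V_def by (rule emeasure_UN_countable) (auto simp: sets cnt disj)
    also have "\<dots> \<le> (\<integral>\<^sup>+w. C * emeasure M (cylinder UNIV w) \<partial>count_space (W n))"
      by (intro nn_integral_mono le)
    also have "\<dots> = C * emeasure M (V n)"
      unfolding V_def by (subst emeasure_UN_countable) (auto simp: sets cnt disj nn_integral_cmult)
    finally show ?thesis .
  qed
  have "emeasure N U = (SUP n. emeasure N (V n))"
    unfolding UV using inc V_sets sets by (intro SUP_emeasure_incseq[symmetric]) auto
  also have "\<dots> \<le> C * emeasure M U"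
  proof (rule SUP_least)
    fix n
    have "emeasure M (V n) \<le> emeasure M U"
      using UV U sets by (intro emeasure_mono) auto
    then show "emeasure N (V n) \<le> C * emeasure M U"
      using V_le[of n] by (meson dual_order.trans mult_left_mono zero_le)
  qed
  finally show ?thesis .
qed

text \<open>
  Outer regularity of finite Borel measures extends the comparison from open to Borel sets. It is
  used on the Polish space of real sequences, of which the integer sequences are a Borel retract.
\<close>

lemma emeasure_le_borel_of_cylinders:
  fixes M N :: "(nat \<Rightarrow> nat) measure"
  assumes sets: "sets M = sets borel" "sets N = sets borel"
    and fin: "finite_measure M" and C: "C < \<infinity>"
    and le: "\<And>w. emeasure N (cylinder UNIV w) \<le> C * emeasure M (cylinder UNIV w)"
    and B: "B \<in> sets borel"
  shows "emeasure N B \<le> C * emeasure M B"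
proof -
  define \<iota> where "\<iota> = (\<lambda>(x::nat \<Rightarrow> nat) n. real (x n))"
  define r where "r = (\<lambda>(y::nat \<Rightarrow> real) n. nat \<lfloor>y n\<rfloor>)"
  have "continuous_on UNIV \<iota>"
    unfolding \<iota>_def
    by (intro continuous_on_coordinatewise_then_product continuous_on_of_nat
        continuous_on_product_coordinates)
  then have \<iota>_open: "open (\<iota> -` U)" if "open U" for U
    using that by (simp add: open_vimage)
  then have \<iota>[measurable]: "\<iota> \<in> borel_measurable borel"
    by (intro borel_measurableI) auto
  have r[measurable]: "r \<in> borel_measurable borel"
    unfolding r_def
  proof (rule measurable_coordinatewise_then_product)
    fix i :: nat
    have "(\<lambda>y::nat \<Rightarrow> real. y i) \<in> borel_measurable borel"
      by (rule measurable_product_coordinates)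
    then show "(\<lambda>y::nat \<Rightarrow> real. nat \<lfloor>y i\<rfloor>) \<in> borel_measurable borel"
      by measurable
  qed
  define A where "A = r -` B"
  have A: "A \<in> sets borel" using measurable_sets[OF r B] by (simp add: A_def)
  have BA: "B = \<iota> -` A" by (auto simp: A_def r_def \<iota>_def)
  let ?M = "distr M borel \<iota>" and ?N = "distr N borel \<iota>"
  have \<iota>M: "\<iota> \<in> measurable M borel" "\<iota> \<in> measurable N borel"
    using sets by (simp_all cong: measurable_cong_sets)
  have sp: "space M = UNIV" "space N = UNIV" using sets by (metis sets_eq_imp_space_eq space_borel)+
  interpret M: finite_measure M by fact
  interpret M': finite_measure ?M by (rule M.finite_measure_distr[OF \<iota>M(1)])
  have "emeasure N B \<le> C * emeasure M (\<iota> -` U)" if "A \<subseteq> U" "open U" for U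
  proof -
    have "emeasure N B \<le> emeasure N (\<iota> -` U)"
      using that \<iota>_open[OF that(2)] sets by (intro emeasure_mono) (auto simp: BA)
    also have "\<dots> \<le> C * emeasure M (\<iota> -` U)"
      by (rule emeasure_le_open_of_cylinders[OF sets le \<iota>_open[OF that(2)]])
    finally show ?thesis .
  qed
  then have "emeasure N B \<le> (INF U\<in>{U. A \<subseteq> U \<and> open U}. emeasure (scale_measure C ?M) U)"
    by (intro INF_greatest) (auto simp: emeasure_distr[OF \<iota>M(1)] sp)
  also have "\<dots> = emeasure (scale_measure C ?M) A"
    using M'.emeasure_finite C
    by (intro outer_regular[symmetric] A)
      (simp_all add: space_scale_measure ennreal_mult_eq_top_iff less_top)
  also have "\<dots> = C * emeasure M B"
    by (simp add: emeasure_distr[OF \<iota>M(1) A] sp BA)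
  finally show ?thesis .
qed

section \<open>Invariant densities of ergodic measures\<close>

text \<open>
  Ergodicity speaks of sets that coincide with their preimage. A set that does so only up to a null
  set differs by a null set from the set of points whose orbit is eventually in it, and the latter
  set is invariant without exceptional points.
\<close>

lemma AE_invariant_imp_trivial:
  assumes "prob_space M" and T[measurable]: "T \<in> measurable M M" and inv: "distr M M T = M"
    and erg: "\<And>B. B \<in> sets M \<Longrightarrow> T -` B \<inter> space M = B \<Longrightarrow> measure M B = 0 \<or> measure M B = 1"
    and B[measurable]: "B \<in> sets M" and AE_B: "AE x in M. T x \<in> B \<longleftrightarrow> x \<in> B"
  shows "measure M B = 0 \<or> measure M B = 1"
proof -
  interpret prob_space M by fact
  have Tn[measurable]: "(T ^^ n) \<in> measurable M M" for n
    by (induction n) auto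
  have "AE x in M. (T ^^ Suc n) x \<in> B \<longleftrightarrow> (T ^^ n) x \<in> B" for n
  proof (induction n)
    case (Suc n)
    then have "AE x in distr M M T. (T ^^ Suc n) x \<in> B \<longleftrightarrow> (T ^^ n) x \<in> B"
      unfolding inv by simp
    from AE_distrD[OF T this] show ?case
      by (simp add: funpow_swap1)
  qed (use AE_B in simp)
  then have "AE x in M. \<forall>n. (T ^^ Suc n) x \<in> B \<longleftrightarrow> (T ^^ n) x \<in> B"
    by (simp only: AE_all_countable) blast
  then have AE_orbit: "AE x in M. \<forall>n. (T ^^ n) x \<in> B \<longleftrightarrow> x \<in> B"
  proof eventually_elim
    case (elim x)
    have "(T ^^ n) x \<in> B \<longleftrightarrow> x \<in> B" for n
      by (induction n) (use elim in auto)
    then show ?case by blast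
  qed
  define B' where "B' = {x \<in> space M. \<exists>n. \<forall>m\<ge>n. (T ^^ m) x \<in> B}"
  have B'[measurable]: "B' \<in> sets M" unfolding B'_def by measurable
  have shift: "(\<exists>n. \<forall>m\<ge>n. (T ^^ m) (T x) \<in> B) \<longleftrightarrow> (\<exists>n. \<forall>m\<ge>n. (T ^^ m) x \<in> B)" for x
  proof
    assume "\<exists>n. \<forall>m\<ge>n. (T ^^ m) (T x) \<in> B"
    then obtain n where n: "\<forall>m\<ge>n. (T ^^ Suc m) x \<in> B"
      by (auto simp: funpow_swap1)
    have "(T ^^ m) x \<in> B" if "m \<ge> Suc n" for m
      using n[rule_format, of "m - 1"] that by (cases m) auto
    then show "\<exists>n. \<forall>m\<ge>n. (T ^^ m) x \<in> B" by blast
  next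
    assume "\<exists>n. \<forall>m\<ge>n. (T ^^ m) x \<in> B"
    then obtain n where "\<forall>m\<ge>n. (T ^^ m) x \<in> B" by blast
    then have "\<forall>m\<ge>n. (T ^^ Suc m) x \<in> B" by (meson le_SucI)
    then show "\<exists>n. \<forall>m\<ge>n. (T ^^ m) (T x) \<in> B" by (auto simp: funpow_swap1)
  qed
  have "T -` B' \<inter> space M = B'"
    using measurable_space[OF T] by (auto simp: B'_def shift)
  then have "measure M B' = 0 \<or> measure M B' = 1" by (rule erg[OF B'])
  moreover have "AE x in M. x \<in> B' \<longleftrightarrow> x \<in> B"
    using AE_orbit AE_space by eventually_elim (auto simp: B'_def)
  then have "measure M B' = measure M B"
    by (intro measure_eq_AE) auto
  ultimately show ?thesis by simp
qed

text \<open>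
  If the signed measure with density \<open>f\<close> is invariant, then the set \<open>B\<close> on which \<open>f\<close> exceeds its
  mean \<open>c\<close> is invariant up to null sets: \<open>f - c\<close> has the same integral over \<open>B\<close> and over \<open>T\<^sup>-\<^sup>1 B\<close>,
  while \<open>B\<close> is the set over which this integral is largest. By ergodicity \<open>B\<close> has measure 0 or 1,
  and measure 1 is impossible as it would push the mean of \<open>f\<close> above \<open>c\<close>.
\<close>

lemma AE_eq_mean_of_invariant_density:
  fixes f :: "'a \<Rightarrow> real"
  assumes "prob_space M" and T[measurable]: "T \<in> measurable M M" and inv: "distr M M T = M"
    and erg: "\<And>B. B \<in> sets M \<Longrightarrow> T -` B \<inter> space M = B \<Longrightarrow> measure M B = 0 \<or> measure M B = 1"
    and f: "integrable M f"
    and f_inv: "\<And>B. B \<in> sets M \<Longrightarrow>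
      (\<integral>x. indicator B (T x) * f x \<partial>M) = (\<integral>x. indicator B x * f x \<partial>M)"
  shows "AE x in M. f x = (\<integral>x. f x \<partial>M)"
proof -
  interpret prob_space M by fact
  note [measurable] = borel_measurable_integrable[OF f]
  define c where "c = (\<integral>x. f x \<partial>M)"
  define B where "B = {x \<in> space M. c < f x}"
  have B[measurable]: "B \<in> sets M" unfolding B_def by measurable
  have TB[measurable]: "T -` B \<inter> space M \<in> sets M" by measurable
  have "measure M B = measure (distr M M T) B" by (simp add: inv)
  also have "\<dots> = measure M (T -` B \<inter> space M)" by (rule measure_distr) auto
  finally have measure_TB: "measure M (T -` B \<inter> space M) = measure M B" ..
  have ind_T: "indicator B (T x) = (indicator (T -` B \<inter> space M) x :: real)" if "x \<in> space M" for x
    using that by (auto simp: indicator_def)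
  have mean_ind: "(\<integral>x. (indicator B (T x) :: real) \<partial>M) = (\<integral>x. (indicator B x :: real) \<partial>M)"
    by (subst Bochner_Integration.integral_cong[OF refl ind_T]) (auto simp: measure_TB)
  have int_ind: "integrable M (\<lambda>x. indicator B (T x) :: real)" "integrable M (\<lambda>x. indicator B x :: real)"
    by (rule integrable_const_bound[of _ 1]; simp)+
  have int_indf: "integrable M (\<lambda>x. indicator B (T x) * f x)" "integrable M (\<lambda>x. indicator B x * f x)"
    by (rule Bochner_Integration.integrable_bound[OF f]; force simp: indicator_def)+
  define D where "D = (\<lambda>x. (indicator B x - indicator B (T x)) * (f x - c))"
  have D_eq: "D = (\<lambda>x. (indicator B x * f x - indicator B (T x) * f x)
      - c * (indicator B x - indicator B (T x)))"
    by (auto simp: D_def algebra_simps)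
  have D_int: "integrable M D"
    unfolding D_eq using int_ind int_indf by simp
  have "(\<integral>x. D x \<partial>M) = 0"
    unfolding D_eq using int_ind int_indf mean_ind f_inv[OF B] by simp
  moreover have "AE x in M. 0 \<le> D x"
    using AE_space by eventually_elim (auto simp: D_def B_def indicator_def)
  ultimately have "AE x in M. D x = 0"
    using integral_nonneg_eq_0_iff_AE[OF D_int] by blast
  then have B_sub: "AE x in M. x \<in> B \<longrightarrow> T x \<in> B"
    using AE_space by eventually_elim (auto simp: D_def B_def indicator_def split: if_splits)
  have "measure M (B \<inter> (T -` B \<inter> space M)) = measure M B"
    using B_sub AE_space by (intro measure_eq_AE) auto
  then have "measure M ((T -` B \<inter> space M) - B) = 0"
    using measure_TB by (subst finite_measure_Diff') (auto simp: Int_commute)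
  then have "AE x in M. x \<notin> (T -` B \<inter> space M) - B"
    by (intro AE_not_in) (auto simp: emeasure_eq_measure null_sets_def)
  then have "AE x in M. T x \<in> B \<longleftrightarrow> x \<in> B"
    using B_sub AE_space by eventually_elim auto
  from AE_invariant_imp_trivial[OF \<open>prob_space M\<close> T inv erg B this]
  have "measure M B = 0 \<or> measure M B = 1" by blast
  moreover have "measure M B \<noteq> 1"
  proof
    assume "measure M B = 1"
    then have "AE x in M. c < f x"
      using prob_eq_1[OF B] by (auto simp: B_def)
    then have "(\<integral>x. c \<partial>M) < (\<integral>x. f x \<partial>M)"
      by (intro integral_less_AE_space) (auto simp: f emeasure_space_1)
    then show False by (simp add: c_def prob_space)
  qed
  ultimately have "measure M B = 0" by blast
  then have "AE x in M. x \<notin> B"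
    by (intro AE_not_in) (auto simp: emeasure_eq_measure null_sets_def)
  then have le: "AE x in M. 0 \<le> c - f x"
    using AE_space by eventually_elim (auto simp: B_def)
  have "(\<integral>x. c - f x \<partial>M) = 0"
    by (simp add: f c_def prob_space)
  then have "AE x in M. c - f x = 0"
    using integral_nonneg_eq_0_iff_AE[of M "\<lambda>x. c - f x"] le f by simp
  then show ?thesis by eventually_elim (simp add: c_def)
qed

section \<open>Hoelder functions and bounded operators\<close>

text \<open>
  A real-valued reformulation of the seminorm, avoiding suprema in the extended half-line: \<open>C\<close> is an
  admissible Hoelder constant of \<open>f\<close>.
\<close>

definition holder_bound ::
  "(nat \<Rightarrow> nat) set \<Rightarrow> real \<Rightarrow> ((nat \<Rightarrow> nat) \<Rightarrow> 'a::real_normed_vector) \<Rightarrow> real \<Rightarrow> bool" where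
  "holder_bound E \<theta> f C \<longleftrightarrow>
    (\<forall>n\<ge>1. \<forall>x\<in>E. \<forall>y\<in>E. (\<forall>i<n. x i = y i) \<longrightarrow> norm (f x - f y) \<le> C * \<theta> ^ n)"

lemma holder_boundD:
  "holder_bound E \<theta> f C \<Longrightarrow> 1 \<le> n \<Longrightarrow> x \<in> E \<Longrightarrow> y \<in> E \<Longrightarrow> (\<And>i. i < n \<Longrightarrow> x i = y i) \<Longrightarrow>
    norm (f x - f y) \<le> C * \<theta> ^ n"
  by (simp add: holder_bound_def)

lemma holder_seminorm_le_iff:
  assumes "0 < \<theta>" "0 \<le> C"
  shows "holder_seminorm E \<theta> f \<le> ennreal C \<longleftrightarrow> holder_bound E \<theta> f C"
proof -
  have "variation E n f / ennreal (\<theta> ^ n) \<le> ennreal C \<longleftrightarrow> variation E n f \<le> ennreal (C * \<theta> ^ n)" for n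
    using assms zero_less_power[OF assms(1), of n]
    by (cases "variation E n f")
      (auto simp: divide_ennreal ennreal_le_iff pos_divide_le_eq ennreal_top_divide top_unique)
  moreover have "variation E n f \<le> ennreal (C * \<theta> ^ n) \<longleftrightarrow>
      (\<forall>x\<in>E. \<forall>y\<in>E. (\<forall>i<n. x i = y i) \<longrightarrow> norm (f x - f y) \<le> C * \<theta> ^ n)" for n
    using assms by (auto simp: variation_def SUP_le_iff ennreal_le_iff)
  ultimately show ?thesis
    by (auto simp: holder_seminorm_def SUP_le_iff holder_bound_def)
qed

lemma holder_bound_seminorm:
  assumes "0 < \<theta>" "holder_seminorm E \<theta> f < \<infinity>"
  shows "holder_bound E \<theta> f (enn2real (holder_seminorm E \<theta> f))"
  using assms by (subst holder_seminorm_le_iff[symmetric]) auto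

lemma holder_bound_imp_continuous_on:
  assumes "0 < \<theta>" "\<theta> < 1" "holder_bound E \<theta> f C"
  shows "continuous_on E f"
  unfolding continuous_on_def
proof (intro ballI tendstoI)
  fix x and e :: real assume x: "x \<in> E" and e: "0 < e"
  have "(\<lambda>n. C * \<theta> ^ Suc n) \<longlonglongrightarrow> C * 0"
    using assms by (intro tendsto_intros LIMSEQ_Suc LIMSEQ_realpow_zero) auto
  then have "eventually (\<lambda>n. C * \<theta> ^ Suc n < e) sequentially"
    using e by (intro order_tendstoD) auto
  then obtain n where n: "C * \<theta> ^ Suc n < e"
    by (auto simp: eventually_sequentially)
  show "\<forall>\<^sub>F y in at x within E. dist (f y) (f x) < e"
    unfolding eventually_at_topological
  proof (intro exI[of _ "cylinder UNIV (map x [0..<Suc n])"] conjI ballI impI)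
    fix y assume "y \<in> cylinder UNIV (map x [0..<Suc n])" "y \<in> E"
    then have "norm (f y - f x) \<le> C * \<theta> ^ Suc n"
      using x by (intro holder_boundD[OF assms(3)]) (simp_all add: mem_cylinder_iff del: upt_Suc)
    then show "dist (f y) (f x) < e" using n by (simp add: dist_norm)
  qed (simp_all add: open_cylinder_UNIV mem_cylinder_iff del: upt_Suc)
qed

lemma mem_bdd_holder_space_iff:
  assumes "0 < \<theta>" "\<theta> < 1"
  shows "f \<in> bdd_holder_space E \<theta> \<longleftrightarrow>
    (\<exists>C\<ge>0. holder_bound E \<theta> f C \<and> (\<forall>x. norm (f x) \<le> C)) \<and> (\<forall>x. x \<notin> E \<longrightarrow> f x = 0)"
    (is "?L \<longleftrightarrow> ?R")
proof
  assume f: ?L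
  let ?C = "enn2real (holder_seminorm E \<theta> f)"
  have C: "holder_bound E \<theta> f ?C" and z: "\<forall>x. x \<notin> E \<longrightarrow> f x = 0"
    using f assms holder_bound_seminorm by (auto simp: bdd_holder_space_def holder_space_def)
  obtain D where D: "\<forall>x\<in>E. norm (f x) \<le> D" "0 < D"
    using f by (auto simp: bdd_holder_space_def bounded_pos)
  have "?C * \<theta> ^ n \<le> (?C + D) * \<theta> ^ n" for n
    using D assms by (intro mult_right_mono) auto
  then have "holder_bound E \<theta> f (?C + D)"
    using C unfolding holder_bound_def by (meson order_trans)
  moreover have "norm (f x) \<le> ?C + D" for x
    using D z by (cases "x \<in> E") (auto simp: add_increasing)
  ultimately show ?R using z D by (intro conjI exI[of _ "?C + D"]) auto
next
  assume ?R
  then obtain C where C: "0 \<le> C" "holder_bound E \<theta> f C" "\<forall>x. norm (f x) \<le> C"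
    and z: "\<forall>x. x \<notin> E \<longrightarrow> f x = 0" by blast
  have "holder_seminorm E \<theta> f \<le> ennreal C"
    using C assms by (simp add: holder_seminorm_le_iff)
  then have "holder_seminorm E \<theta> f < \<infinity>"
    by (metis ennreal_less_top infinity_ennreal_def order_le_less_trans)
  then show ?L
    using C z holder_bound_imp_continuous_on[OF assms C(2)]
    by (auto simp: bdd_holder_space_def holder_space_def bounded_iff)
qed

locale holder_exponent =
  fixes E :: "(nat \<Rightarrow> nat) set" and \<theta> :: real
  assumes theta: "0 < \<theta>" "\<theta> < 1"
begin

abbreviation "X \<equiv> bdd_holder_space E \<theta> :: ((nat \<Rightarrow> nat) \<Rightarrow> complex) set"

lemma bddE:
  assumes "f \<in> bdd_holder_space E \<theta>"
  obtains C where "0 \<le> C" "holder_bound E \<theta> f C" "\<And>x. norm (f x) \<le> C" "\<And>x. x \<notin> E \<Longrightarrow> f x = 0"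
  using assms unfolding mem_bdd_holder_space_iff[OF theta] by blast

lemma bddI:
  assumes "0 \<le> C" "holder_bound E \<theta> f C" "\<And>x. norm (f x) \<le> C" "\<And>x. x \<notin> E \<Longrightarrow> f x = 0"
  shows "f \<in> bdd_holder_space E \<theta>"
  using assms unfolding mem_bdd_holder_space_iff[OF theta] by blast

lemma bdd_mult:
  fixes f g :: "(nat \<Rightarrow> nat) \<Rightarrow> 'a::real_normed_algebra"
  assumes "f \<in> bdd_holder_space E \<theta>" "g \<in> bdd_holder_space E \<theta>"
  shows "(\<lambda>x. f x * g x) \<in> bdd_holder_space E \<theta>"
proof -
  obtain C where C: "0 \<le> C" "holder_bound E \<theta> f C" "\<And>x. norm (f x) \<le> C"
      "\<And>x. x \<notin> E \<Longrightarrow> f x = 0"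
    using assms by (elim bddE) blast
  obtain D where D: "0 \<le> D" "holder_bound E \<theta> g D" "\<And>x. norm (g x) \<le> D"
    using assms by (elim bddE) blast
  have "norm (f x * g x - f y * g y) \<le> (2 * C * D) * \<theta> ^ n"
    if n: "1 \<le> n" "x \<in> E" "y \<in> E" "\<forall>i<n. x i = y i" for n x y
  proof -
    have "f x * g x - f y * g y = (f x - f y) * g x + f y * (g x - g y)"
      by (simp add: algebra_simps)
    also have "norm \<dots> \<le> norm (f x - f y) * norm (g x) + norm (f y) * norm (g x - g y)"
      by (meson add_mono norm_mult_ineq norm_triangle_le)
    also have "\<dots> \<le> (C * \<theta> ^ n) * D + C * (D * \<theta> ^ n)"
      using n C D theta
      by (intro add_mono mult_mono holder_boundD[OF C(2)] holder_boundD[OF D(2)]) auto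
    finally show ?thesis by (simp add: algebra_simps)
  qed
  then have "holder_bound E \<theta> (\<lambda>x. f x * g x) (2 * C * D)"
    by (auto simp: holder_bound_def)
  moreover have "norm (f x * g x) \<le> 2 * C * D" for x
  proof -
    have "norm (f x * g x) \<le> C * D"
      using C D by (meson mult_mono norm_ge_zero norm_mult_ineq order_trans)
    then show ?thesis using mult_nonneg_nonneg[OF C(1) D(1)] by linarith
  qed
  ultimately show ?thesis using C D by (intro bddI[of "2 * C * D"]) auto
qed

lemma bdd_lincomb:
  fixes f g :: "(nat \<Rightarrow> nat) \<Rightarrow> complex"
  assumes "f \<in> X" "g \<in> X"
  shows "(\<lambda>x. a * f x + b * g x) \<in> X"
proof -
  obtain C where C: "0 \<le> C" "holder_bound E \<theta> f C" "\<And>x. norm (f x) \<le> C"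
      "\<And>x. x \<notin> E \<Longrightarrow> f x = 0"
    using assms by (elim bddE) blast
  obtain D where D: "0 \<le> D" "holder_bound E \<theta> g D" "\<And>x. norm (g x) \<le> D"
      "\<And>x. x \<notin> E \<Longrightarrow> g x = 0"
    using assms by (elim bddE) blast
  have "norm ((a * f x + b * g x) - (a * f y + b * g y)) \<le> (norm a * C + norm b * D) * \<theta> ^ n"
    if n: "1 \<le> n" "x \<in> E" "y \<in> E" "\<forall>i<n. x i = y i" for n x y
  proof -
    have "(a * f x + b * g x) - (a * f y + b * g y) = a * (f x - f y) + b * (g x - g y)"
      by (simp add: algebra_simps)
    also have "norm \<dots> \<le> norm a * norm (f x - f y) + norm b * norm (g x - g y)"
      by (metis norm_mult norm_triangle_ineq)
    also have "\<dots> \<le> norm a * (C * \<theta> ^ n) + norm b * (D * \<theta> ^ n)"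
      using n by (intro add_mono mult_left_mono holder_boundD[OF C(2)] holder_boundD[OF D(2)]) auto
    finally show ?thesis by (simp add: algebra_simps)
  qed
  then have "holder_bound E \<theta> (\<lambda>x. a * f x + b * g x) (norm a * C + norm b * D)"
    by (auto simp: holder_bound_def)
  moreover have "norm (a * f x + b * g x) \<le> norm a * C + norm b * D" for x
  proof -
    have "norm (a * f x + b * g x) \<le> norm a * norm (f x) + norm b * norm (g x)"
      by (metis norm_mult norm_triangle_ineq)
    also have "\<dots> \<le> norm a * C + norm b * D"
      using C D by (intro add_mono mult_left_mono) auto
    finally show ?thesis .
  qed
  ultimately show ?thesis using C D by (intro bddI[of "norm a * C + norm b * D"]) auto
qed

lemma bdd_scale: "f \<in> X \<Longrightarrow> (\<lambda>x. a * f x) \<in> X"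
  using bdd_lincomb[of f f a 0] by simp

lemma bdd_of_real:
  assumes "f \<in> bdd_holder_space E \<theta>"
  shows "(\<lambda>x. complex_of_real (f x)) \<in> X"
proof -
  obtain C where C: "0 \<le> C" "holder_bound E \<theta> f C" "\<And>x. norm (f x) \<le> C"
      "\<And>x. x \<notin> E \<Longrightarrow> f x = 0"
    using assms by (elim bddE) blast
  have "holder_bound E \<theta> (\<lambda>x. complex_of_real (f x)) C"
    using C(2) unfolding holder_bound_def by (metis norm_of_real of_real_diff real_norm_def)
  then show ?thesis
    using C by (intro bddI[of C]) auto
qed

lemma bdd_locally_constant:
  fixes f :: "(nat \<Rightarrow> nat) \<Rightarrow> complex"
  assumes "\<And>x y. x \<in> E \<Longrightarrow> y \<in> E \<Longrightarrow> (\<And>i. i < m \<Longrightarrow> x i = y i) \<Longrightarrow> f x = f y"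
    and "\<And>x. norm (f x) \<le> 1" "\<And>x. x \<notin> E \<Longrightarrow> f x = 0"
  shows "f \<in> X"
proof (rule bddI)
  \<comment> \<open>points that agree in fewer than \<open>m\<close> letters are handled by the trivial bound 2 on the difference\<close>
  show "holder_bound E \<theta> f (2 / \<theta> ^ m)"
    unfolding holder_bound_def
  proof (intro allI ballI impI)
    fix n x y assume n: "1 \<le> n" "x \<in> E" "y \<in> E" "\<forall>i<n. x i = y i"
    show "norm (f x - f y) \<le> 2 / \<theta> ^ m * \<theta> ^ n"
    proof (cases "m \<le> n")
      case True
      then have "f x = f y" using n by (intro assms(1)) auto
      then show ?thesis using theta by simp
    next
      case False
      have "norm (f x - f y) \<le> 1 + 1"
        using assms(2)[of x] assms(2)[of y] norm_triangle_ineq4[of "f x" "f y"] by linarith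
      also have "\<dots> \<le> 2 * (\<theta> ^ n / \<theta> ^ m)"
        using theta False power_decreasing[of n m \<theta>] by (simp add: field_simps)
      finally show ?thesis by simp
    qed
  qed
  have "1 \<le> 2 / \<theta> ^ m"
    using theta power_le_one[of \<theta> m] by (simp add: field_simps)
  then show "norm (f x) \<le> 2 / \<theta> ^ m" for x
    using assms(2)[of x] by linarith
qed (use theta assms in auto)

text \<open>
  Every estimate of the norm below goes through an admissible Hoelder constant and a sup bound,
  which the following two lemmas extract from the norm and reassemble to it.
\<close>

lemma holder_normE:
  fixes f :: "(nat \<Rightarrow> nat) \<Rightarrow> complex"
  assumes "f \<in> X"
  obtains C D where "holder_norm E \<theta> f = C + D" "0 \<le> C" "holder_bound E \<theta> f C"
    "\<And>x. x \<in> E \<Longrightarrow> norm (f x) \<le> D"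
proof
  have "holder_seminorm E \<theta> f < \<infinity>"
    using assms by (simp add: bdd_holder_space_def holder_space_def)
  then show "holder_bound E \<theta> f (enn2real (holder_seminorm E \<theta> f))"
    using theta holder_bound_seminorm by blast
  obtain C where "\<And>x. norm (f x) \<le> C" using assms by (elim bddE) blast
  then have "bdd_above ((\<lambda>x. norm (f x)) ` E)" by (intro bdd_aboveI2)
  then show "norm (f x) \<le> (SUP x\<in>E. norm (f x))" if "x \<in> E" for x
    using that by (intro cSUP_upper)
qed (simp_all add: holder_norm_def)

lemma holder_norm_le:
  fixes f :: "(nat \<Rightarrow> nat) \<Rightarrow> complex"
  assumes "E \<noteq> {}" "0 \<le> C" "holder_bound E \<theta> f C" "\<And>x. x \<in> E \<Longrightarrow> norm (f x) \<le> D"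
  shows "holder_norm E \<theta> f \<le> C + D"
proof -
  have "holder_seminorm E \<theta> f \<le> ennreal C"
    using assms theta by (simp add: holder_seminorm_le_iff)
  then have "enn2real (holder_seminorm E \<theta> f) \<le> C"
    using assms(2) by (metis enn2real_ennreal enn2real_mono ennreal_less_top)
  moreover have "(SUP x\<in>E. norm (f x)) \<le> D"
    using assms by (intro cSUP_least)
  ultimately show ?thesis by (simp add: holder_norm_def)
qed

lemma norm_le_holder_norm: "f \<in> X \<Longrightarrow> x \<in> E \<Longrightarrow> norm (f x) \<le> holder_norm E \<theta> f"
  by (elim holder_normE) (metis add_increasing)

lemma holder_norm_nonneg: "f \<in> X \<Longrightarrow> E \<noteq> {} \<Longrightarrow> 0 \<le> holder_norm E \<theta> f"
  by (metis all_not_in_conv norm_ge_zero norm_le_holder_norm order_trans)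

lemma holder_norm_lincomb:
  fixes f g :: "(nat \<Rightarrow> nat) \<Rightarrow> complex"
  assumes "E \<noteq> {}" "f \<in> X" "g \<in> X"
  shows "holder_norm E \<theta> (\<lambda>x. a * f x + b * g x)
    \<le> norm a * holder_norm E \<theta> f + norm b * holder_norm E \<theta> g"
proof -
  obtain C D where f: "holder_norm E \<theta> f = C + D" "0 \<le> C" "holder_bound E \<theta> f C"
    "\<And>x. x \<in> E \<Longrightarrow> norm (f x) \<le> D" using assms by (elim holder_normE) blast
  obtain C' D' where g: "holder_norm E \<theta> g = C' + D'" "0 \<le> C'" "holder_bound E \<theta> g C'"
    "\<And>x. x \<in> E \<Longrightarrow> norm (g x) \<le> D'" using assms by (elim holder_normE) blast
  have tri: "norm (a * s + b * t) \<le> norm a * S + norm b * T"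
    if "norm s \<le> S" "norm t \<le> T" for s t and S T :: real
  proof -
    have "norm (a * s + b * t) \<le> norm a * norm s + norm b * norm t"
      by (metis norm_mult norm_triangle_ineq)
    also have "\<dots> \<le> norm a * S + norm b * T"
      using that by (intro add_mono mult_left_mono) auto
    finally show ?thesis .
  qed
  have "holder_bound E \<theta> (\<lambda>x. a * f x + b * g x) (norm a * C + norm b * C')"
    unfolding holder_bound_def
  proof (intro allI ballI impI)
    fix n x y assume n: "1 \<le> n" "x \<in> E" "y \<in> E" "\<forall>i<n. x i = y i"
    have "norm (a * (f x - f y) + b * (g x - g y)) \<le> norm a * (C * \<theta> ^ n) + norm b * (C' * \<theta> ^ n)"
      using n by (intro tri holder_boundD[OF f(3)] holder_boundD[OF g(3)]) auto
    then show "norm ((a * f x + b * g x) - (a * f y + b * g y)) \<le> (norm a * C + norm b * C') * \<theta> ^ n"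
      by (simp add: algebra_simps)
  qed
  then have "holder_norm E \<theta> (\<lambda>x. a * f x + b * g x)
      \<le> (norm a * C + norm b * C') + (norm a * D + norm b * D')"
    using f g assms by (intro holder_norm_le tri) auto
  then show ?thesis using f(1) g(1) by (simp add: algebra_simps)
qed

lemma bounded_operators_lincomb:
  assumes "E \<noteq> {}" "T \<in> bounded_operators E \<theta>" "S \<in> bounded_operators E \<theta>"
  shows "(\<lambda>g x. a * T g x + b * S g x) \<in> bounded_operators E \<theta>"
proof -
  obtain C where C: "\<forall>g\<in>X. holder_norm E \<theta> (T g) \<le> C * holder_norm E \<theta> g"
    using assms(2) by (auto simp: bounded_operators_def)
  obtain C' where C': "\<forall>g\<in>X. holder_norm E \<theta> (S g) \<le> C' * holder_norm E \<theta> g"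
    using assms(3) by (auto simp: bounded_operators_def)
  have X: "T g \<in> X" "S g \<in> X" if "g \<in> X" for g
    using that assms by (auto simp: bounded_operators_def)
  have "holder_norm E \<theta> (\<lambda>x. a * T g x + b * S g x)
      \<le> (norm a * C + norm b * C') * holder_norm E \<theta> g" if g: "g \<in> X" for g
  proof -
    have "holder_norm E \<theta> (\<lambda>x. a * T g x + b * S g x)
        \<le> norm a * holder_norm E \<theta> (T g) + norm b * holder_norm E \<theta> (S g)"
      by (intro holder_norm_lincomb X g assms)
    also have "\<dots> \<le> norm a * (C * holder_norm E \<theta> g) + norm b * (C' * holder_norm E \<theta> g)"
      using C C' g by (intro add_mono mult_left_mono) auto
    finally show ?thesis by (simp add: algebra_simps)
  qed
  moreover have "a * (c * s) + b * (c * t) = c * (a * s + b * t)"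
    "a * (s + s') + b * (t + t') = (a * s + b * t) + (a * s' + b * t')" for c s s' t t' :: complex
    by (simp_all add: algebra_simps)
  moreover have "T (\<lambda>x. g x + g' x) = (\<lambda>x. T g x + T g' x)" "S (\<lambda>x. g x + g' x) = (\<lambda>x. S g x + S g' x)"
    "T (\<lambda>x. c * g x) = (\<lambda>x. c * T g x)" "S (\<lambda>x. c * g x) = (\<lambda>x. c * S g x)"
    if "g \<in> X" "g' \<in> X" for g g' c
    using that assms(2,3) unfolding bounded_operators_def by blast+
  ultimately show ?thesis
    using bdd_lincomb[OF X] unfolding bounded_operators_def
    by (intro CollectI conjI ballI allI exI[of _ "norm a * C + norm b * C'"]) simp_all
qed

lemma norm_le_operator_norm:
  assumes "E \<noteq> {}" "T \<in> bounded_operators E \<theta>" "g \<in> X" "x \<in> E"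
  shows "norm (T g x) \<le> operator_norm E \<theta> T * holder_norm E \<theta> g"
proof -
  obtain C where "\<forall>g\<in>X. holder_norm E \<theta> (T g) \<le> C * holder_norm E \<theta> g"
    using assms(2) by (auto simp: bounded_operators_def)
  then have C: "holder_norm E \<theta> (T g) \<le> C * holder_norm E \<theta> g" if "g \<in> X" for g
    using that by blast
  have TX: "T g \<in> X" if "g \<in> X" for g
    using that assms by (auto simp: bounded_operators_def)
  have T_scale: "T (\<lambda>x. c * g x) = (\<lambda>x. c * T g x)" for c
    using assms by (auto simp: bounded_operators_def)
  show ?thesis
  proof (cases "holder_norm E \<theta> g = 0")
    case True
    then have "holder_norm E \<theta> (T g) \<le> 0" using C[OF assms(3)] by simp
    with norm_le_holder_norm[OF TX[OF assms(3)] assms(4)] have "norm (T g x) \<le> 0"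
      by linarith
    then show ?thesis using True by simp
  next
    case False
    then have pos: "0 < holder_norm E \<theta> g"
      using holder_norm_nonneg[OF assms(3,1)] by simp
    define g' where "g' = (\<lambda>x. complex_of_real (inverse (holder_norm E \<theta> g)) * g x)"
    have g': "g' \<in> X" unfolding g'_def by (rule bdd_scale[OF assms(3)])
    have "holder_norm E \<theta> g' \<le> norm (complex_of_real (inverse (holder_norm E \<theta> g))) * holder_norm E \<theta> g"
      using holder_norm_lincomb[OF assms(1,3,3), of _ 0] by (simp add: g'_def)
    also have "\<dots> = 1" using pos by (simp add: norm_inverse)
    finally have g'_le: "holder_norm E \<theta> g' \<le> 1" .
    have bdd: "bdd_above ((\<lambda>g. holder_norm E \<theta> (T g)) ` {g \<in> X. holder_norm E \<theta> g \<le> 1})"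
    proof (rule bdd_aboveI2)
      fix g assume g: "g \<in> {g \<in> X. holder_norm E \<theta> g \<le> 1}"
      then have "holder_norm E \<theta> (T g) \<le> C * holder_norm E \<theta> g" using C by simp
      also have "\<dots> \<le> \<bar>C\<bar> * holder_norm E \<theta> g"
        using g assms(1) by (intro mult_right_mono holder_norm_nonneg) auto
      also have "\<dots> \<le> \<bar>C\<bar> * 1" using g by (intro mult_left_mono) auto
      finally show "holder_norm E \<theta> (T g) \<le> \<bar>C\<bar> * 1" .
    qed
    have "norm (T g' x) \<le> holder_norm E \<theta> (T g')"
      by (rule norm_le_holder_norm[OF TX[OF g'] assms(4)])
    also have "\<dots> \<le> operator_norm E \<theta> T"
      unfolding operator_norm_def using g' g'_le by (intro cSUP_upper bdd) auto
    finally have "norm (T g' x) \<le> operator_norm E \<theta> T" .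
    moreover have "T g' x = T g x / complex_of_real (holder_norm E \<theta> g)"
      unfolding g'_def T_scale using pos by (simp add: field_simps)
    ultimately show ?thesis using pos by (simp add: norm_divide field_simps)
  qed
qed

lemma operator_holomorphic_imp_uniform_derivative:
  assumes "E \<noteq> {}" "operator_holomorphic_on E \<theta> H U" "open U" "z \<in> U" "g \<in> X"
  obtains D where "D \<in> X" "uniform_limit E (\<lambda>w x. (H w g x - H z g x) / (w - z)) D (at z)"
proof -
  define Q where "Q D w = (\<lambda>g x. (H w g x - H z g x) / (w - z) - D g x)" for D :: operator and w
  obtain D where D: "D \<in> bounded_operators E \<theta>"
    and lim: "((\<lambda>w. operator_norm E \<theta> (Q D w)) \<longlongrightarrow> 0) (at z)"
    using assms(2,4) at_within_open[OF assms(4,3)]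
    unfolding operator_holomorphic_on_def Q_def by auto
  have HB: "H w \<in> bounded_operators E \<theta>" if "w \<in> U" for w
    using assms(2) that by (simp add: operator_holomorphic_on_def)
  have Q: "Q D w \<in> bounded_operators E \<theta>" if "w \<in> U" for w
  proof -
    have "(\<lambda>g x. 1 * (1 / (w - z) * H w g x + (- 1 / (w - z)) * H z g x) + (- 1) * D g x)
        \<in> bounded_operators E \<theta>"
      by (intro bounded_operators_lincomb assms(1) D HB that assms(4))
    then show ?thesis by (simp add: Q_def diff_divide_distrib)
  qed
  have "uniform_limit E (\<lambda>w x. (H w g x - H z g x) / (w - z)) (D g) (at z)"
  proof (rule uniform_limitI)
    fix e :: real assume e: "0 < e"
    let ?n = "holder_norm E \<theta> g"
    have n: "0 \<le> ?n" by (rule holder_norm_nonneg[OF assms(5,1)])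
    then have "0 < e / (?n + 1)" using e by simp
    then have "\<forall>\<^sub>F w in at z. operator_norm E \<theta> (Q D w) < e / (?n + 1)"
      using lim by (intro order_tendstoD)
    moreover have "\<forall>\<^sub>F w in at z. w \<in> U"
      using assms by (intro eventually_at_in_open') auto
    ultimately show "\<forall>\<^sub>F w in at z. \<forall>x\<in>E. dist ((H w g x - H z g x) / (w - z)) (D g x) < e"
    proof eventually_elim
      case (elim w)
      show ?case
      proof
        fix x assume "x \<in> E"
        then have "norm (Q D w g x) \<le> operator_norm E \<theta> (Q D w) * ?n"
          by (intro norm_le_operator_norm assms Q elim)
        also have "\<dots> \<le> e / (?n + 1) * ?n" using elim n by (intro mult_right_mono) auto
        also have "\<dots> < e" using e n by (simp add: field_simps)
        finally show "dist ((H w g x - H z g x) / (w - z)) (D g x) < e"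
          by (simp add: dist_norm Q_def)
      qed
    qed
  qed
  moreover have "D g \<in> X" using D assms(5) by (auto simp: bounded_operators_def)
  ultimately show ?thesis using that by blast
qed

end

section \<open>The transfer operator and its eigenmeasure\<close>

lemma transfer_operator_mult_shift:
  "transfer_operator E f (\<lambda>y. G (shift y) * g y) = (\<lambda>\<omega>. G \<omega> * transfer_operator E f g \<omega>)"
proof
  fix \<omega>
  have "transfer_operator E f (\<lambda>y. G (shift y) * g y) \<omega>
      = (\<Sum>\<^sub>\<infinity>y\<in>{y \<in> E. shift y = \<omega>}. G \<omega> * (exp (f y) * g y))"
    unfolding transfer_operator_def by (intro infsum_cong) (auto simp: algebra_simps)
  then show "transfer_operator E f (\<lambda>y. G (shift y) * g y) \<omega> = G \<omega> * transfer_operator E f g \<omega>"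
    by (simp add: transfer_operator_def infsum_cmult_right')
qed

lemma transfer_operator_weight:
  assumes "\<And>y. y \<in> E \<Longrightarrow> exp (f' y) = exp (f y) * W y"
  shows "transfer_operator E f' g = transfer_operator E f (\<lambda>y. W y * g y)"
  unfolding transfer_operator_def by (intro ext infsum_cong) (auto simp: assms algebra_simps)

lemma shift_eq_imp_eq: "shift x = shift y \<Longrightarrow> x 0 = y 0 \<Longrightarrow> x = y"
proof
  fix n assume "shift x = shift y" "x 0 = y 0"
  then show "x n = y n" by (cases n) (auto simp: shift_def fun_eq_iff)
qed

lemma birkhoff_sum_Suc: "birkhoff_sum (Suc n) u \<omega> = u \<omega> + birkhoff_sum n u (shift \<omega>)"
  unfolding birkhoff_sum_def by (simp add: sum.lessThan_Suc_shift funpow_swap1 del: sum.lessThan_Suc)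

lemma abs_exp_minus_diff_le:
  fixes s t :: real
  assumes "0 \<le> s" "0 \<le> t"
  shows "\<bar>exp (- s) - exp (- t)\<bar> \<le> \<bar>s - t\<bar>"
proof -
  have *: "exp (- s) - exp (- t) \<le> t - s" if "0 \<le> s" "s \<le> t" for s t :: real
  proof -
    have "exp (- s) - exp (- t) = exp (- s) * (1 - exp (- (t - s)))"
      by (simp add: algebra_simps flip: exp_add)
    also have "\<dots> \<le> 1 * (t - s)"
    proof (intro mult_mono)
      show "1 - exp (- (t - s)) \<le> t - s"
        using exp_ge_add_one_self[of "- (t - s)"] by linarith
    qed (use that in auto)
    finally show ?thesis by simp
  qed
  show ?thesis using *[of s t] *[of t s] assms by (cases "s \<le> t") auto
qed

context holder_exponent begin

lemma exp_weight_bdd: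
  assumes \<xi>: "\<xi> \<in> holder_space E \<theta>" "\<And>y. y \<in> E \<Longrightarrow> 0 \<le> \<xi> y" and a: "0 \<le> a"
  shows "(\<lambda>y. if y \<in> E then complex_of_real (exp (- (a * \<xi> y))) else 0) \<in> X"
proof (rule bddI)
  let ?C = "enn2real (holder_seminorm E \<theta> \<xi>)"
  let ?W = "\<lambda>y. if y \<in> E then complex_of_real (exp (- (a * \<xi> y))) else 0"
  have \<xi>C: "holder_bound E \<theta> \<xi> ?C"
    using \<xi>(1) theta by (intro holder_bound_seminorm) (auto simp: holder_space_def)
  show "holder_bound E \<theta> ?W (a * ?C + 1)"
    unfolding holder_bound_def
  proof (intro allI ballI impI)
    fix n x y assume n: "1 \<le> n" "x \<in> E" "y \<in> E" "\<forall>i<n. x i = y i"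
    have "norm (?W x - ?W y) = \<bar>exp (- (a * \<xi> x)) - exp (- (a * \<xi> y))\<bar>"
      using n by (simp flip: of_real_diff)
    also have "\<dots> \<le> \<bar>a * \<xi> x - a * \<xi> y\<bar>"
      using a \<xi>(2) n by (intro abs_exp_minus_diff_le) auto
    also have "\<dots> = a * \<bar>\<xi> x - \<xi> y\<bar>"
      using a by (simp add: abs_mult flip: right_diff_distrib)
    also have "\<dots> \<le> a * (?C * \<theta> ^ n)"
      using holder_boundD[OF \<xi>C, of n x y] n a by (intro mult_left_mono) auto
    also have "\<dots> \<le> (a * ?C + 1) * \<theta> ^ n"
      using theta by (simp add: algebra_simps)
    finally show "norm (?W x - ?W y) \<le> (a * ?C + 1) * \<theta> ^ n" .
  qed
  show "norm (?W x) \<le> a * ?C + 1" for x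
  proof -
    have "norm (?W x) \<le> 1" using a \<xi>(2)[of x] by auto
    then show ?thesis using a by (simp add: add_increasing)
  qed
qed (use a in auto)

end

text \<open>
  At the pole the pressure vanishes, so the eigenvalue of the eigenmeasure is 1: integrals with respect
  to it do not change when the transfer operator is applied to the integrand. This is the substitute
  for shift invariance in all integrals below.
\<close>

locale conformal_measure = holder_exponent +
  fixes I A u \<nu>
  assumes E_eq: "E = shift_space I A"
    and prob_nu: "prob_space \<nu>" and sets_nu: "sets \<nu> = sets (restrict_space borel E)"
    and dual_fixed: "\<And>g. g \<in> X \<Longrightarrow>
      (\<integral>x. transfer_operator E (\<lambda>y. complex_of_real (u y)) g x \<partial>\<nu>) = (\<integral>x. g x \<partial>\<nu>)"
begin

sublocale nu: prob_space \<nu> by (rule prob_nu)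

abbreviation "L \<equiv> transfer_operator E (\<lambda>y. complex_of_real (u y))"

lemma space_nu: "space \<nu> = E"
  using sets_eq_imp_space_eq[OF sets_nu] by (simp add: space_restrict_space)

lemma shift_E: "y \<in> E \<Longrightarrow> shift y \<in> E"
  by (auto simp: E_eq shift_space_def shift_def)

lemma measurable_id_nu: "(\<lambda>x. x) \<in> measurable \<nu> borel"
  using measurable_restrict_space1[OF measurable_ident] measurable_cong_sets[OF sets_nu refl]
  by (auto simp: id_def)

lemma measurable_of_continuous_on:
  fixes f :: "(nat \<Rightarrow> nat) \<Rightarrow> 'b::topological_space"
  shows "continuous_on E f \<Longrightarrow> f \<in> borel_measurable \<nu>"
  using borel_measurable_continuous_on_restrict measurable_cong_sets[OF sets_nu refl] by blast

lemma X_measurable: "f \<in> X \<Longrightarrow> f \<in> borel_measurable \<nu>"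
  by (intro measurable_of_continuous_on) (simp add: bdd_holder_space_def holder_space_def)

lemma X_integrable:
  assumes "f \<in> X"
  shows "integrable \<nu> f"
proof -
  obtain C where "\<And>x. norm (f x) \<le> C" using assms by (elim bddE) blast
  then show ?thesis by (intro nu.integrable_const_bound[of _ C] X_measurable assms) auto
qed

lemma indicator_cylinder_bdd: "(\<lambda>x. indicator (cylinder E w) x) \<in> X"
  by (rule bdd_locally_constant[of "length w"]) (auto simp: indicator_def mem_cylinder_iff)

lemma indicator_cylinder_shift_bdd:
  "(\<lambda>x. if x \<in> E then indicator (cylinder E w) (shift x) else 0) \<in> X"
  by (rule bdd_locally_constant[of "Suc (length w)"])
    (auto simp: indicator_def mem_cylinder_iff shift_E, auto simp: shift_def)

lemma sets_cylinder: "cylinder E w \<in> sets \<nu>"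
  unfolding sets_nu cylinder_eq_Int[of E] sets_restrict_space
  using borel_open[OF open_cylinder_UNIV] by blast

lemma integral_complex_indicator:
  assumes "S \<in> sets \<nu>"
  shows "(\<integral>x. (indicator S x :: complex) \<partial>\<nu>) = complex_of_real (measure \<nu> S)"
proof -
  have "(\<integral>x. (indicator S x :: complex) \<partial>\<nu>) = (\<integral>x. complex_of_real (indicator S x) \<partial>\<nu>)"
    by (intro Bochner_Integration.integral_cong) (auto simp: indicator_def)
  then show ?thesis using assms by simp
qed

text \<open>
  The image of the indicator of the cylinder \<open>[a w]\<close> lives on \<open>[w]\<close>, as a sequence has at most one
  preimage with first letter \<open>a\<close>; its values are those of \<open>exp u\<close> on \<open>[a w]\<close>.
\<close>

lemma measure_cylinder_Suc_le:
  assumes V: "holder_bound E \<theta> u V" and \<tau>: "\<tau> \<in> E"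
  shows "measure \<nu> (cylinder E (map \<tau> [0..<Suc n]))
    \<le> exp (u \<tau> + V * \<theta> ^ Suc n) * measure \<nu> (cylinder E (map (shift \<tau>) [0..<n]))"
proof -
  define w where "w = map \<tau> [0..<Suc n]"
  define c where "c = cylinder E w"
  define d where "d = cylinder E (map (shift \<tau>) [0..<n])"
  let ?K = "exp (u \<tau> + V * \<theta> ^ Suc n)"
  have c_iff: "y \<in> c \<longleftrightarrow> y \<in> E \<and> (\<forall>i<Suc n. y i = \<tau> i)" for y
    by (auto simp: c_def w_def mem_cylinder_iff simp del: upt_Suc)
  have d_iff: "y \<in> d \<longleftrightarrow> y \<in> E \<and> (\<forall>i<n. y i = \<tau> (Suc i))" for y
    by (auto simp: d_def mem_cylinder_iff shift_def)
  have sets_c: "c \<in> sets \<nu>" and sets_d: "d \<in> sets \<nu>"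
    unfolding c_def d_def by (rule sets_cylinder)+
  have bound: "norm (L (indicator c) \<omega>) \<le> ?K * indicator d \<omega>" for \<omega>
  proof -
    define S where "S = {y \<in> E. shift y = \<omega>} \<inter> c"
    have L_eq: "L (indicator c) \<omega> = (\<Sum>\<^sub>\<infinity>y\<in>S. exp (complex_of_real (u y)))"
      unfolding transfer_operator_def S_def by (intro infsum_cong_neutral) auto
    show ?thesis
    proof (cases "S = {}")
      case True
      then show ?thesis unfolding L_eq by simp
    next
      case False
      then obtain y where "y \<in> S" by blast
      have S_D: "z \<in> E" "shift z = \<omega>" "z \<in> c" "\<And>i. i < Suc n \<Longrightarrow> z i = \<tau> i" if "z \<in> S" for z
        using that c_iff[of z] unfolding S_def by blast+
      note y = S_D[OF \<open>y \<in> S\<close>]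
      have "z = y" if "z \<in> S" for z
        by (rule shift_eq_imp_eq)
          (simp_all only: S_D(2)[OF that] y(2) S_D(4)[OF that zero_less_Suc] y(4)[OF zero_less_Suc])
      then have "S = {y}" using \<open>y \<in> S\<close> by blast
      then have "norm (L (indicator c) \<omega>) = exp (u y)"
        unfolding L_eq by simp
      also have "\<dots> \<le> ?K"
        using holder_boundD[OF V _ y(1) \<tau> y(4)] by fastforce
      finally have "norm (L (indicator c) \<omega>) \<le> ?K" .
      moreover have "\<omega> \<in> d"
        unfolding d_iff using y(4) shift_E[OF y(1)] y(2) by (auto simp: shift_def)
      ultimately show ?thesis by simp
    qed
  qed
  have c_X: "(indicator c :: _ \<Rightarrow> complex) \<in> X"
    using indicator_cylinder_bdd[of w] by (simp add: c_def)
  have "measure \<nu> c = norm (\<integral>x. (indicator c x :: complex) \<partial>\<nu>)"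
    by (simp add: integral_complex_indicator sets_c)
  also have "\<dots> = norm (\<integral>x. L (indicator c) x \<partial>\<nu>)"
    using dual_fixed[OF c_X] by simp
  also have "\<dots> \<le> (\<integral>x. norm (L (indicator c) x) \<partial>\<nu>)"
    by (rule integral_norm_bound)
  also have "\<dots> \<le> (\<integral>x. ?K * indicator d x \<partial>\<nu>)"
    using sets_d nu.emeasure_finite
    by (intro integral_mono' bound integrable_mult_right integrable_real_indicator) (auto simp flip: less_top)
  also have "\<dots> = ?K * measure \<nu> d"
    using sets_d by simp
  finally show ?thesis by (simp only: c_def d_def w_def)
qed

text \<open>
  Iterating the previous estimate, the distortions \<open>V * \<theta> ^ k\<close> sum up to a bounded quantity. This is
  the upper half of the Gibbs property of \<open>\<nu>\<close>.
\<close>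

lemma measure_cylinder_le_birkhoff_sum:
  assumes V: "holder_bound E \<theta> u V" "0 \<le> V" and \<tau>: "\<tau> \<in> E"
  shows "measure \<nu> (cylinder E (map \<tau> [0..<n])) \<le> exp (birkhoff_sum n u \<tau> + V / (1 - \<theta>))"
proof -
  have "measure \<nu> (cylinder E (map \<tau> [0..<n])) \<le> exp (birkhoff_sum n u \<tau> + V * (\<Sum>k<n. \<theta> ^ Suc k))"
    using \<tau>
  proof (induction n arbitrary: \<tau>)
    case 0
    then show ?case by (simp add: birkhoff_sum_def)
  next
    case (Suc n)
    have "measure \<nu> (cylinder E (map \<tau> [0..<Suc n]))
        \<le> exp (u \<tau> + V * \<theta> ^ Suc n) * measure \<nu> (cylinder E (map (shift \<tau>) [0..<n]))"
      by (rule measure_cylinder_Suc_le[OF V(1) Suc.prems])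
    also have "\<dots> \<le> exp (u \<tau> + V * \<theta> ^ Suc n)
        * exp (birkhoff_sum n u (shift \<tau>) + V * (\<Sum>k<n. \<theta> ^ Suc k))"
      by (intro mult_left_mono Suc.IH shift_E Suc.prems) auto
    also have "\<dots> = exp (birkhoff_sum (Suc n) u \<tau> + V * (\<Sum>k<Suc n. \<theta> ^ Suc k))"
      by (simp add: birkhoff_sum_Suc algebra_simps flip: exp_add)
    finally show ?case .
  qed
  also have "(\<Sum>k<n. \<theta> ^ Suc k) \<le> 1 / (1 - \<theta>)"
  proof -
    have "(\<Sum>k<n. \<theta> ^ Suc k) \<le> (\<Sum>k<n. \<theta> ^ k)"
      using theta by (intro sum_mono power_decreasing) auto
    also have "\<dots> = (1 - \<theta> ^ n) / (1 - \<theta>)" using theta by (simp add: sum_gp_strict)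
    also have "\<dots> \<le> 1 / (1 - \<theta>)" using theta by (intro divide_right_mono) auto
    finally show ?thesis .
  qed
  then have "exp (birkhoff_sum n u \<tau> + V * (\<Sum>k<n. \<theta> ^ Suc k))
      \<le> exp (birkhoff_sum n u \<tau> + V / (1 - \<theta>))"
    using mult_left_mono[OF _ V(2)] by fastforce
  finally show ?thesis .
qed

text \<open>
  For a fixed density the sets that satisfy the identity form a Dynkin system, and the cylinders are a
  generator of the Borel sets that is stable under intersection.
\<close>

lemma integral_shift_invariant:
  fixes \<phi> :: "(nat \<Rightarrow> nat) \<Rightarrow> complex"
  assumes \<phi>: "integrable \<nu> \<phi>" and shift: "shift \<in> measurable \<nu> \<nu>"
    and cyl: "\<And>w. (\<integral>x. indicator (cylinder E w) (shift x) * \<phi> x \<partial>\<nu>)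
      = (\<integral>x. indicator (cylinder E w) x * \<phi> x \<partial>\<nu>)"
    and B: "B \<in> sets \<nu>"
  shows "(\<integral>x. indicator B (shift x) * \<phi> x \<partial>\<nu>) = (\<integral>x. indicator B x * \<phi> x \<partial>\<nu>)"
proof -
  have shiftb: "shift \<in> measurable \<nu> borel"
    using measurable_compose[OF shift measurable_id_nu] by simp
  let ?P = "\<lambda>S. (LINT x:(shift -` S \<inter> E)|\<nu>. \<phi> x) = (LINT x:(S \<inter> E)|\<nu>. \<phi> x)"
  have sets: "shift -` S \<inter> E \<in> sets \<nu>" "S \<inter> E \<in> sets \<nu>" if "S \<in> sets borel" for S
    using measurable_sets[OF shiftb that] measurable_sets[OF measurable_id_nu that] by (auto simp: space_nu)
  have int: "set_integrable \<nu> S \<phi>" if "S \<in> sets \<nu>" for S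
    using integrable_mult_indicator[OF that \<phi>] by (simp add: set_integrable_def)
  have P_iff: "?P S \<longleftrightarrow> (\<integral>x. indicator S (shift x) * \<phi> x \<partial>\<nu>) = (\<integral>x. indicator S x * \<phi> x \<partial>\<nu>)" for S
  proof -
    have "(LINT x:(shift -` S \<inter> E)|\<nu>. \<phi> x) = (\<integral>x. indicator S (shift x) * \<phi> x \<partial>\<nu>)"
      "(LINT x:(S \<inter> E)|\<nu>. \<phi> x) = (\<integral>x. indicator S x * \<phi> x \<partial>\<nu>)"
      unfolding set_lebesgue_integral_def
      by (intro Bochner_Integration.integral_cong; simp add: space_nu indicator_def)+
    then show ?thesis by simp
  qed
  have "?P S" if "S \<in> sets borel" for S
  proof -
    have gen: "insert {} (range (cylinder UNIV)) \<subseteq> Pow UNIV" by simp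
    have "S \<in> sigma_sets UNIV (insert {} (range (cylinder UNIV)))"
      using that by (simp add: borel_eq_sigma_cylinders)
    from Int_stable_cylinders gen this show "?P S"
    proof (induction S rule: sigma_sets_induct_disjoint)
      case (basic S)
      then consider "S = {}" | w where "S = cylinder UNIV w" by auto
      then show ?case
      proof cases
        case 2
        have "(\<integral>x. indicator S (shift x) * \<phi> x \<partial>\<nu>) = (\<integral>x. indicator (cylinder E w) (shift x) * \<phi> x \<partial>\<nu>)"
          "(\<integral>x. indicator S x * \<phi> x \<partial>\<nu>) = (\<integral>x. indicator (cylinder E w) x * \<phi> x \<partial>\<nu>)"
          unfolding 2 cylinder_eq_Int[of E]
          by (intro Bochner_Integration.integral_cong; simp add: space_nu indicator_def shift_E)+
        then show ?thesis unfolding P_iff using cyl by simp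
      qed simp
    next
      case (compl S)
      then have S: "S \<in> sets borel" by (simp add: borel_eq_sigma_cylinders)
      have diff: "(LINT x:(E - S')|\<nu>. \<phi> x) = (LINT x:E|\<nu>. \<phi> x) - (LINT x:S'|\<nu>. \<phi> x)"
        if "S' \<in> sets \<nu>" "S' \<subseteq> E" "E \<in> sets \<nu>" for S'
      proof -
        have "(LINT x:(S' \<union> (E - S'))|\<nu>. \<phi> x) = (LINT x:S'|\<nu>. \<phi> x) + (LINT x:(E - S')|\<nu>. \<phi> x)"
          using that by (intro set_integral_Un int) auto
        moreover have "S' \<union> (E - S') = E" using that by auto
        ultimately show ?thesis by simp
      qed
      have E: "E \<in> sets \<nu>" using sets.top[of \<nu>] by (simp add: space_nu)
      have "shift -` (UNIV - S) \<inter> E = E - (shift -` S \<inter> E)" "(UNIV - S) \<inter> E = E - (S \<inter> E)"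
        by auto
      then show ?case using diff[OF sets(1)[OF S] _ E] diff[OF sets(2)[OF S] _ E] compl.IH by simp
    next
      case (union S)
      then have S: "S i \<in> sets borel" for i by (auto simp: borel_eq_sigma_cylinders)
      have disj: "S i \<inter> S j = {}" if "i \<noteq> j" for i j
        using union.hyps(1) that by (auto simp: disjoint_family_on_def)
      have U: "\<Union> (range S) \<in> sets borel" using S by blast
      have eq: "shift -` (\<Union> (range S)) \<inter> E = (\<Union>i. shift -` S i \<inter> E)"
        "\<Union> (range S) \<inter> E = (\<Union>i. S i \<inter> E)" by auto
      have "(LINT x:(\<Union>i. shift -` S i \<inter> E)|\<nu>. \<phi> x) = (\<Sum>i. LINT x:(shift -` S i \<inter> E)|\<nu>. \<phi> x)"
      proof (rule lebesgue_integral_countable_add)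
        show "set_integrable \<nu> (\<Union>i. shift -` S i \<inter> E) \<phi>"
          using int[OF sets(1)[OF U]] by (simp only: eq)
      qed (use disj sets(1)[OF S] in blast)+
      moreover have "(LINT x:(\<Union>i. S i \<inter> E)|\<nu>. \<phi> x) = (\<Sum>i. LINT x:(S i \<inter> E)|\<nu>. \<phi> x)"
      proof (rule lebesgue_integral_countable_add)
        show "set_integrable \<nu> (\<Union>i. S i \<inter> E) \<phi>"
          using int[OF sets(2)[OF U]] by (simp only: eq)
      qed (use disj sets(2)[OF S] in blast)+
      ultimately show ?case unfolding eq using union.IH by simp
    qed simp_all
  qed
  moreover obtain S where S: "S \<in> sets borel" "B = E \<inter> S"
    using B unfolding sets_nu sets_restrict_space by auto
  moreover have "(\<integral>x. indicator B (shift x) * \<phi> x \<partial>\<nu>) = (\<integral>x. indicator S (shift x) * \<phi> x \<partial>\<nu>)"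
    "(\<integral>x. indicator B x * \<phi> x \<partial>\<nu>) = (\<integral>x. indicator S x * \<phi> x \<partial>\<nu>)"
    unfolding S by (intro Bochner_Integration.integral_cong; simp add: space_nu indicator_def shift_E)+
  ultimately show ?thesis using P_iff[of S] by simp
qed

end

section \<open>Approaching the pole\<close>

context conformal_measure begin

lemma integral_indicator_shift_eq:
  assumes "q \<in> X"
  shows "(\<integral>x. indicator (cylinder E w) (shift x) * q x \<partial>\<nu>)
    = (\<integral>x. indicator (cylinder E w) x * L q x \<partial>\<nu>)"
proof -
  let ?G = "indicator (cylinder E w) :: _ \<Rightarrow> complex"
  have "q x = 0" if "x \<notin> E" for x
    using assms that by (elim bddE) blast
  then have "(\<lambda>x. (if x \<in> E then ?G (shift x) else 0) * q x) = (\<lambda>x. ?G (shift x) * q x)"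
    by fastforce
  then have "(\<lambda>x. ?G (shift x) * q x) \<in> X"
    using bdd_mult[OF indicator_cylinder_shift_bdd[of w] assms] by simp
  from dual_fixed[OF this] show ?thesis
    by (simp add: transfer_operator_mult_shift)
qed

text \<open>
  The functions \<open>F n\<close> are the resolvents \<open>(Id - \<L>)\<^sup>-\<^sup>1 g\<close> at parameters approaching the pole from the
  left, multiplied by the (negative) distance \<open>- a n\<close> to the pole. Pairing the resolvent equation
  with \<open>\<nu>\<close> turns the transfer operator into the bounded weight \<open>exp (- a n * \<xi>)\<close>; in the limit the
  weight disappears at zeroth order and leaves \<open>- \<xi>\<close> at first order.
\<close>

lemma resolvent_limit:
  fixes a :: "nat \<Rightarrow> real" and \<xi> :: "(nat \<Rightarrow> nat) \<Rightarrow> real"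
  defines "W \<equiv> \<lambda>n y. if y \<in> E then complex_of_real (exp (- (a n * \<xi> y))) else 0"
  assumes \<xi>: "\<xi> \<in> holder_space E \<theta>" "\<And>y. y \<in> E \<Longrightarrow> 0 \<le> \<xi> y" "integrable \<nu> \<xi>"
    and a: "\<And>n. 0 < a n" "a \<longlonglongrightarrow> 0"
    and g: "g \<in> X" and F: "\<And>n. F n \<in> X" and f: "f \<in> X"
    and conv: "\<And>x. x \<in> E \<Longrightarrow> (\<lambda>n. F n x) \<longlonglongrightarrow> f x"
    and bound: "\<And>n x. x \<in> E \<Longrightarrow> norm (F n x) \<le> M"
    and eq: "\<And>n. L (\<lambda>y. W n y * F n y) = (\<lambda>x. F n x + complex_of_real (a n) * g x)"
  shows "(\<integral>x. indicator (cylinder E w) (shift x) * f x \<partial>\<nu>)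
      = (\<integral>x. indicator (cylinder E w) x * f x \<partial>\<nu>)" (is ?invariant)
    and "(\<integral>x. complex_of_real (\<xi> x) * f x \<partial>\<nu>) = - (\<integral>x. g x \<partial>\<nu>)" (is ?first_order)
proof -
  let ?G = "indicator (cylinder E w) :: _ \<Rightarrow> complex"
  have W: "W n \<in> X" for n
    unfolding W_def using exp_weight_bdd[OF \<xi>(1,2), of "a n"] a(1)[of n] by simp
  have WF: "(\<lambda>y. W n y * F n y) \<in> X" for n by (rule bdd_mult[OF W F])
  have W_conv: "(\<lambda>n. W n x) \<longlonglongrightarrow> 1" if "x \<in> E" for x
  proof -
    have "(\<lambda>n. complex_of_real (exp (- (a n * \<xi> x)))) \<longlonglongrightarrow> complex_of_real (exp (- (0 * \<xi> x)))"
      by (intro tendsto_intros a)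
    then show ?thesis using that by (simp add: W_def)
  qed
  have W_le: "norm (W n x) \<le> 1" for n x
    using \<xi>(2)[of x] a(1)[of n] by (auto simp: W_def)
  obtain Mg where Mg: "\<And>x. norm (g x) \<le> Mg" "0 \<le> Mg" using g by (elim bddE) blast
  obtain a0 where a0: "\<And>n. a n \<le> a0"
    using a(2) by (metis convergentI convergent_imp_Bseq Bseq_def abs_le_D1 real_norm_def)
  have X_meas: "q \<in> borel_measurable \<nu>" if "q \<in> X" for q by (rule X_measurable[OF that])
  have Gs: "(\<lambda>x. if x \<in> E then ?G (shift x) else 0) \<in> borel_measurable \<nu>"
    by (intro X_meas indicator_cylinder_shift_bdd)
  have Gs_meas: "(\<lambda>x. ?G (shift x) * q x) \<in> borel_measurable \<nu>" if "q \<in> X" for q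
  proof -
    have "(\<lambda>x. ?G (shift x)) \<in> borel_measurable \<nu>"
      using Gs by (rule measurable_cong[THEN iffD1, rotated]) (simp add: space_nu)
    then show ?thesis using X_meas[OF that] by measurable
  qed
  have G_meas: "?G \<in> borel_measurable \<nu>"
    using X_meas[OF indicator_cylinder_bdd] by simp
  have G_le: "norm (?G x) \<le> 1" for x by (simp add: indicator_def)
  have gF_conv: "(\<lambda>n. F n x + complex_of_real (a n) * g x) \<longlonglongrightarrow> f x" if "x \<in> E" for x
    using tendsto_add[OF conv[OF that] tendsto_mult[OF tendsto_of_real[OF a(2)] tendsto_const]]
    by simp
  have "(\<lambda>n. \<integral>x. ?G (shift x) * (W n x * F n x) \<partial>\<nu>) \<longlonglongrightarrow> (\<integral>x. ?G (shift x) * f x \<partial>\<nu>)"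
  proof (rule integral_dominated_convergence[where w = "\<lambda>_. M"])
    show "AE x in \<nu>. (\<lambda>n. ?G (shift x) * (W n x * F n x)) \<longlonglongrightarrow> ?G (shift x) * f x"
    proof (rule AE_I2)
      fix x assume "x \<in> space \<nu>"
      then have "x \<in> E" by (simp add: space_nu)
      then have "(\<lambda>n. ?G (shift x) * (W n x * F n x)) \<longlonglongrightarrow> ?G (shift x) * (1 * f x)"
        by (intro tendsto_intros W_conv conv)
      then show "(\<lambda>n. ?G (shift x) * (W n x * F n x)) \<longlonglongrightarrow> ?G (shift x) * f x" by simp
    qed
    show "AE x in \<nu>. norm (?G (shift x) * (W n x * F n x)) \<le> M" for n
    proof (rule AE_I2)
      fix x assume "x \<in> space \<nu>"
      then have "norm (F n x) \<le> M" using bound by (simp add: space_nu)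
      moreover have "norm (?G (shift x) * (W n x * F n x)) \<le> 1 * (1 * norm (F n x))"
        unfolding norm_mult by (intro mult_mono W_le G_le) auto
      ultimately show "norm (?G (shift x) * (W n x * F n x)) \<le> M" by simp
    qed
  qed (use Gs_meas WF f in auto)
  moreover have "(\<lambda>n. \<integral>x. ?G x * (F n x + complex_of_real (a n) * g x) \<partial>\<nu>) \<longlonglongrightarrow> (\<integral>x. ?G x * f x \<partial>\<nu>)"
  proof (rule integral_dominated_convergence[where w = "\<lambda>_. M + a0 * Mg"])
    show "AE x in \<nu>. (\<lambda>n. ?G x * (F n x + complex_of_real (a n) * g x)) \<longlonglongrightarrow> ?G x * f x"
      by (intro AE_I2 tendsto_mult tendsto_const gF_conv) (simp add: space_nu)
    show "AE x in \<nu>. norm (?G x * (F n x + complex_of_real (a n) * g x)) \<le> M + a0 * Mg" for n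
    proof (rule AE_I2)
      fix x assume "x \<in> space \<nu>"
      then have "norm (F n x) \<le> M" using bound by (simp add: space_nu)
      moreover have "norm (complex_of_real (a n) * g x) \<le> a0 * Mg"
        unfolding norm_mult using a(1)[of n] a0[of n] Mg by (intro mult_mono) auto
      ultimately have "norm (F n x + complex_of_real (a n) * g x) \<le> M + a0 * Mg"
        by (rule norm_triangle_mono)
      moreover have "norm (?G x * (F n x + complex_of_real (a n) * g x))
          \<le> 1 * norm (F n x + complex_of_real (a n) * g x)"
        unfolding norm_mult by (intro mult_right_mono G_le) auto
      ultimately show "norm (?G x * (F n x + complex_of_real (a n) * g x)) \<le> M + a0 * Mg" by simp
    qed
  qed (use G_meas X_meas[OF F] X_meas[OF f] X_meas[OF g] in \<open>auto intro!: borel_measurable_times borel_measurable_add\<close>)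
  moreover have "(\<integral>x. ?G (shift x) * (W n x * F n x) \<partial>\<nu>)
      = (\<integral>x. ?G x * (F n x + complex_of_real (a n) * g x) \<partial>\<nu>)" for n
    using integral_indicator_shift_eq[OF WF[of n], of w] by (simp add: eq)
  ultimately show ?invariant
    using LIMSEQ_unique by auto

  have first_n: "(\<integral>x. (1 - W n x) / complex_of_real (a n) * F n x \<partial>\<nu>) = - (\<integral>x. g x \<partial>\<nu>)" for n
  proof -
    have "(\<integral>x. W n x * F n x \<partial>\<nu>) = (\<integral>x. F n x \<partial>\<nu>) + complex_of_real (a n) * (\<integral>x. g x \<partial>\<nu>)"
      using dual_fixed[OF WF[of n]] X_integrable[OF F[of n]] X_integrable[OF g] by (simp add: eq)
    then have "(\<integral>x. F n x - W n x * F n x \<partial>\<nu>) = - complex_of_real (a n) * (\<integral>x. g x \<partial>\<nu>)"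
      using X_integrable[OF F[of n]] X_integrable[OF WF[of n]] by simp
    moreover have "(\<integral>x. (1 - W n x) / complex_of_real (a n) * F n x \<partial>\<nu>)
        = (\<integral>x. inverse (complex_of_real (a n)) * (F n x - W n x * F n x) \<partial>\<nu>)"
      by (simp add: field_simps)
    ultimately show ?thesis using a(1)[of n] by simp
  qed
  have quot_conv: "(\<lambda>n. (1 - W n x) / complex_of_real (a n)) \<longlonglongrightarrow> complex_of_real (\<xi> x)"
    if x: "x \<in> E" for x
  proof -
    have "((\<lambda>t. - exp (- (t * \<xi> x))) has_real_derivative \<xi> x) (at 0)"
      by (auto intro!: derivative_eq_intros)
    then have "((\<lambda>t. (1 - exp (- (t * \<xi> x))) / t) \<longlongrightarrow> \<xi> x) (at 0)"
      by (simp add: has_field_derivative_iff)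
    moreover have "filterlim a (at 0) sequentially"
      using a(2) less_imp_neq[OF a(1)] by (intro filterlim_atI) (auto simp: eventually_sequentially)
    ultimately have "(\<lambda>n. (1 - exp (- (a n * \<xi> x))) / a n) \<longlonglongrightarrow> \<xi> x"
      by (rule filterlim_compose)
    from tendsto_of_real[OF this, where 'a = complex] show ?thesis using x by (simp add: W_def)
  qed
  have quot_le: "norm ((1 - W n x) / complex_of_real (a n)) \<le> \<xi> x" if x: "x \<in> E" for n x
  proof -
    have "(1 - W n x) / complex_of_real (a n) = complex_of_real ((1 - exp (- (a n * \<xi> x))) / a n)"
      using x by (simp add: W_def)
    also have "norm \<dots> = (1 - exp (- (a n * \<xi> x))) / a n"
      using a(1)[of n] \<xi>(2)[OF x] by (simp only: norm_of_real) auto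
    also have "\<dots> \<le> \<xi> x"
      using a(1)[of n] exp_ge_add_one_self[of "- (a n * \<xi> x)"]
      by (simp add: pos_divide_le_eq mult.commute)
    finally show ?thesis .
  qed
  have "(\<lambda>n. \<integral>x. (1 - W n x) / complex_of_real (a n) * F n x \<partial>\<nu>)
      \<longlonglongrightarrow> (\<integral>x. complex_of_real (\<xi> x) * f x \<partial>\<nu>)"
  proof (rule integral_dominated_convergence[where w = "\<lambda>x. \<xi> x * M"])
    show "AE x in \<nu>. (\<lambda>n. (1 - W n x) / complex_of_real (a n) * F n x)
        \<longlonglongrightarrow> complex_of_real (\<xi> x) * f x"
      by (intro AE_I2 tendsto_mult quot_conv conv) (simp_all add: space_nu)
    show "AE x in \<nu>. norm ((1 - W n x) / complex_of_real (a n) * F n x) \<le> \<xi> x * M" for n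
    proof (rule AE_I2)
      fix x assume "x \<in> space \<nu>"
      then have "x \<in> E" by (simp add: space_nu)
      then show "norm ((1 - W n x) / complex_of_real (a n) * F n x) \<le> \<xi> x * M"
        unfolding norm_mult by (intro mult_mono quot_le bound \<xi>(2)) auto
    qed
    show "(\<lambda>x. (1 - W n x) / complex_of_real (a n) * F n x) \<in> borel_measurable \<nu>" for n
      using X_meas[OF W[of n]] X_meas[OF F[of n]] by measurable
    show "(\<lambda>x. complex_of_real (\<xi> x) * f x) \<in> borel_measurable \<nu>"
      using borel_measurable_integrable[OF \<xi>(3)] X_meas[OF f] by measurable
  qed (use \<xi>(3) in auto)
  then show ?first_order
    unfolding first_n by (simp add: LIMSEQ_const_iff)
qed

end

section \<open>Comparison with the ergodic Gibbs state\<close>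

text \<open>
  \<open>\<mu>\<close> is the ergodic Gibbs state of a potential \<open>u\<close> of pressure 0, which is why the usual factor
  \<open>exp (n * P)\<close> is absent from the Gibbs inequalities.
\<close>

locale gibbs_pair = conformal_measure +
  fixes \<mu> V
  assumes holder_u: "holder_bound E \<theta> u V" "0 \<le> V"
    and prob_mu: "prob_space \<mu>" and sets_mu: "sets \<mu> = sets \<nu>"
    and gibbs: "\<exists>c>0. \<forall>\<omega>\<in>E. \<forall>n.
      inverse c \<le> measure \<mu> (cylinder E (map \<omega> [0..<n])) / exp (birkhoff_sum n u \<omega>) \<and>
      measure \<mu> (cylinder E (map \<omega> [0..<n])) / exp (birkhoff_sum n u \<omega>) \<le> c"
    and shift_mu: "shift \<in> measurable \<mu> \<mu>" "distr \<mu> \<mu> shift = \<mu>"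
    and ergodic_mu: "\<And>B. B \<in> sets \<mu> \<Longrightarrow> shift -` B \<inter> space \<mu> = B \<Longrightarrow>
      measure \<mu> B = 0 \<or> measure \<mu> B = 1"
begin

sublocale mu: prob_space \<mu> by (rule prob_mu)

lemma space_mu: "space \<mu> = E"
  using sets_eq_imp_space_eq[OF sets_mu] by (simp add: space_nu)

lemma measure_mu_cylinder_pos:
  assumes "\<omega> \<in> E"
  shows "0 < measure \<mu> (cylinder E (map \<omega> [0..<n]))"
proof -
  obtain c where "0 < c" "inverse c \<le> measure \<mu> (cylinder E (map \<omega> [0..<n])) / exp (birkhoff_sum n u \<omega>)"
    using gibbs assms by blast
  then have "0 < measure \<mu> (cylinder E (map \<omega> [0..<n])) / exp (birkhoff_sum n u \<omega>)"
    by (meson less_le_trans positive_imp_inverse_positive)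
  then show ?thesis by (simp add: zero_less_divide_iff)
qed

text \<open>
  On cylinders, the upper half of the Gibbs property for \<open>\<nu>\<close> meets the lower half for \<open>\<mu>\<close>.
\<close>

lemma nu_le_mu:
  obtains K where "0 \<le> K" "\<And>B. B \<in> sets \<nu> \<Longrightarrow> emeasure \<nu> B \<le> ennreal K * emeasure \<mu> B"
proof -
  obtain c where c: "0 < c" "\<And>\<omega> n. \<omega> \<in> E \<Longrightarrow>
      inverse c \<le> measure \<mu> (cylinder E (map \<omega> [0..<n])) / exp (birkhoff_sum n u \<omega>)"
    using gibbs by blast
  define K where "K = c * exp (V / (1 - \<theta>))"
  have K: "0 \<le> K" using c by (simp add: K_def)
  have cyl: "measure \<nu> (cylinder E w) \<le> K * measure \<mu> (cylinder E w)" for w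
  proof (cases "cylinder E w = {}")
    case False
    then obtain \<tau> where \<tau>: "\<tau> \<in> E" "w = map \<tau> [0..<length w]"
      by (auto simp: cylinder_def)
    let ?n = "length w"
    have "measure \<nu> (cylinder E w) \<le> exp (birkhoff_sum ?n u \<tau> + V / (1 - \<theta>))"
      using measure_cylinder_le_birkhoff_sum[OF holder_u \<tau>(1), of ?n] \<tau>(2) by simp
    also have "\<dots> = exp (V / (1 - \<theta>)) * exp (birkhoff_sum ?n u \<tau>)"
      by (simp add: exp_add)
    also have "exp (birkhoff_sum ?n u \<tau>) \<le> c * measure \<mu> (cylinder E w)"
      using c(2)[OF \<tau>(1), of ?n] c(1) \<tau>(2) by (simp add: field_simps)
    finally show ?thesis by (simp add: K_def mult_left_mono algebra_simps)
  qed simp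
  have id: "(\<lambda>x. x) \<in> measurable \<nu> borel" "(\<lambda>x. x) \<in> measurable \<mu> borel"
    using measurable_id_nu measurable_cong_sets[OF sets_mu refl] by blast+
  let ?M = "distr \<mu> borel (\<lambda>x. x)" and ?N = "distr \<nu> borel (\<lambda>x. x)"
  have M: "emeasure ?M S = emeasure \<mu> (E \<inter> S)" "emeasure ?N S = emeasure \<nu> (E \<inter> S)"
    if "S \<in> sets borel" for S
    using that id by (simp_all add: emeasure_distr space_mu space_nu Int_commute)
  have le: "emeasure ?N (cylinder UNIV w) \<le> ennreal K * emeasure ?M (cylinder UNIV w)" for w
    using cyl[of w] K
    by (simp add: M borel_open open_cylinder_UNIV nu.emeasure_eq_measure mu.emeasure_eq_measure
        flip: cylinder_eq_Int ennreal_mult')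
  have "emeasure \<nu> B \<le> ennreal K * emeasure \<mu> B" if B: "B \<in> sets \<nu>" for B
  proof -
    obtain S where S: "S \<in> sets borel" "B = E \<inter> S"
      using B unfolding sets_nu sets_restrict_space by auto
    have "finite_measure ?M" by (rule mu.finite_measure_distr[OF id(2)])
    from emeasure_le_borel_of_cylinders[OF _ _ this _ le S(1)]
    show ?thesis using S by (simp add: M)
  qed
  with K that show ?thesis by blast
qed

lemma integrable_nu_of_mu:
  fixes f :: "(nat \<Rightarrow> nat) \<Rightarrow> real"
  assumes "integrable \<mu> f"
  shows "integrable \<nu> f"
proof -
  obtain K where K: "0 \<le> K" "\<And>B. B \<in> sets \<nu> \<Longrightarrow> emeasure \<nu> B \<le> ennreal K * emeasure \<mu> B"
    using nu_le_mu by blast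
  have meas: "f \<in> borel_measurable \<mu>" using assms by auto
  then have meas_nu: "f \<in> borel_measurable \<nu>"
    using measurable_cong_sets[OF sets_mu refl] by blast
  have "\<nu> \<le> scale_measure (ennreal K) \<mu>"
    using K(2) sets_mu by (subst le_measure) auto
  then have "(\<integral>\<^sup>+x. norm (f x) \<partial>\<nu>) \<le> (\<integral>\<^sup>+x. norm (f x) \<partial>scale_measure (ennreal K) \<mu>)"
    using sets_mu by (intro nn_integral_mono_measure) auto
  also have "\<dots> = ennreal K * (\<integral>\<^sup>+x. norm (f x) \<partial>\<mu>)"
    using meas by (intro nn_integral_scale_measure) auto
  also have "\<dots> < \<infinity>"
    using assms by (simp add: integrable_iff_bounded ennreal_mult_less_top)
  finally show ?thesis using meas_nu by (simp add: integrable_iff_bounded)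
qed

lemma density_nu:
  obtains k :: "(nat \<Rightarrow> nat) \<Rightarrow> real"
  where "k \<in> borel_measurable \<mu>" "\<And>x. 0 \<le> k x" "\<nu> = density \<mu> (\<lambda>x. ennreal (k x))"
proof -
  obtain K where K: "\<And>B. B \<in> sets \<nu> \<Longrightarrow> emeasure \<nu> B \<le> ennreal K * emeasure \<mu> B"
    using nu_le_mu by blast
  have ac: "absolutely_continuous \<mu> \<nu>"
    using K sets_mu by (force simp: absolutely_continuous_def null_sets_def)
  obtain k where k: "k \<in> borel_measurable \<mu>" "AE x in \<mu>. RN_deriv \<mu> \<nu> x = ennreal (k x)" "\<And>x. 0 \<le> k x"
    using mu.real_RN_deriv[OF nu.finite_measure_axioms ac] sets_mu by metis
  have "\<nu> = density \<mu> (RN_deriv \<mu> \<nu>)"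
    using mu.density_RN_deriv[OF ac] sets_mu by simp
  also have "\<dots> = density \<mu> (\<lambda>x. ennreal (k x))"
    using k by (intro density_cong) auto
  finally show ?thesis using that k by blast
qed

text \<open>
  Functions in \<open>X\<close> are continuous on \<open>E\<close>, and \<open>\<mu>\<close> charges every nonempty cylinder.
\<close>

lemma eq_of_AE_eq:
  assumes "f \<in> X" "g \<in> X" and AE: "AE x in \<mu>. f x = g x" and x: "x \<in> E"
  shows "f x = g x"
proof (rule ccontr)
  assume neq: "f x \<noteq> g x"
  have "continuous_on E (\<lambda>y. f y - g y)"
    using assms(1,2) by (intro continuous_on_diff) (auto simp: bdd_holder_space_def holder_space_def)
  then have "openin (top_of_set E) (E \<inter> (\<lambda>y. f y - g y) -` (- {0}))"
    by (intro continuous_openin_preimage_gen) auto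
  then obtain U where U: "open U" "E \<inter> (\<lambda>y. f y - g y) -` (- {0}) = E \<inter> U"
    by (auto simp: openin_open)
  then have "x \<in> U" using x neq by auto
  then obtain n where n: "cylinder UNIV (map x [0..<n]) \<subseteq> U"
    using open_contains_cylinder[OF U(1)] by (metis order_refl)
  let ?c = "cylinder E (map x [0..<n])"
  have sub: "f y \<noteq> g y" if "y \<in> ?c" for y
  proof -
    have "y \<in> E \<inter> U" using that n by (auto simp: mem_cylinder_iff)
    then have "y \<in> E \<inter> (\<lambda>y. f y - g y) -` (- {0})" by (simp only: U(2))
    then show ?thesis by simp
  qed
  have "AE y in \<mu>. y \<notin> ?c" using AE by eventually_elim (use sub in blast)
  then have "?c \<in> null_sets \<mu>"
    using sets_cylinder sets_mu by (subst AE_iff_null_sets) auto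
  then show False
    using measure_mu_cylinder_pos[OF x, of n] by (simp add: null_sets_def measure_def)
qed

lemma AE_density_times_invariant:
  fixes \<phi> :: "(nat \<Rightarrow> nat) \<Rightarrow> complex"
  assumes k: "k \<in> borel_measurable \<mu>" "\<And>x. 0 \<le> k x" "\<nu> = density \<mu> (\<lambda>x. ennreal (k x))"
    and \<phi>: "integrable \<nu> \<phi>"
    and cyl: "\<And>w. (\<integral>x. indicator (cylinder E w) (shift x) * \<phi> x \<partial>\<nu>)
      = (\<integral>x. indicator (cylinder E w) x * \<phi> x \<partial>\<nu>)"
  shows "AE x in \<mu>. complex_of_real (k x) * \<phi> x = (\<integral>x. \<phi> x \<partial>\<nu>)"
proof -
  have shift_nu: "shift \<in> measurable \<nu> \<nu>"
    using shift_mu(1) measurable_cong_sets[OF sets_mu sets_mu] by simp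
  have real_case: "AE x in \<mu>. k x * T (\<phi> x) = T (\<integral>x. \<phi> x \<partial>\<nu>)"
    if T: "bounded_linear (T :: complex \<Rightarrow> real)" for T
  proof -
    have T\<phi>: "integrable \<nu> (\<lambda>x. T (\<phi> x))" by (rule integrable_bounded_linear[OF T \<phi>])
    have meas: "(\<lambda>x. T (\<phi> x)) \<in> borel_measurable \<mu>"
      using borel_measurable_integrable[OF T\<phi>] measurable_cong_sets[OF sets_mu refl] by blast
    have transport: "(\<integral>x. q x * T (\<phi> x) \<partial>\<nu>) = (\<integral>x. q x * (k x * T (\<phi> x)) \<partial>\<mu>)"
      if "q \<in> borel_measurable \<mu>" for q :: "_ \<Rightarrow> real"
      unfolding k(3) using k(1,2) meas that
      by (subst integral_density) (auto simp: algebra_simps)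
    have int_k: "integrable \<mu> (\<lambda>x. k x * T (\<phi> x))"
      using T\<phi> k(1,2) meas unfolding k(3) by (subst (asm) integrable_density) auto
    have "AE x in \<mu>. k x * T (\<phi> x) = (\<integral>x. k x * T (\<phi> x) \<partial>\<mu>)"
    proof (rule AE_eq_mean_of_invariant_density[OF prob_mu shift_mu])
      show "measure \<mu> B = 0 \<or> measure \<mu> B = 1"
        if "B \<in> sets \<mu>" "shift -` B \<inter> space \<mu> = B" for B
        using that by (rule ergodic_mu)
      show "integrable \<mu> (\<lambda>x. k x * T (\<phi> x))" by (rule int_k)
      fix B assume B: "B \<in> sets \<mu>"
      have int: "integrable \<nu> (\<lambda>x. indicator S (G x) * \<phi> x)"
        if "G \<in> measurable \<nu> \<nu>" "S \<in> sets \<nu>" for S G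
      proof (rule Bochner_Integration.integrable_bound[OF \<phi>])
        show "(\<lambda>x. indicator S (G x) * \<phi> x) \<in> borel_measurable \<nu>"
          using that \<phi> by measurable
      qed (auto simp: indicator_def)
      have Tind: "T (indicator S y * c) = indicator S y * T c" for S and y :: "nat \<Rightarrow> nat" and c
        using linear_0[OF bounded_linear.linear[OF T]] by (auto simp: indicator_def)
      have B': "B \<in> sets \<nu>" using B sets_mu by simp
      have "(\<integral>x. indicator B (shift x) * T (\<phi> x) \<partial>\<nu>) = T (\<integral>x. indicator B (shift x) * \<phi> x \<partial>\<nu>)"
        using integral_bounded_linear[OF T int[OF shift_nu B']] by (simp add: Tind)
      also have "\<dots> = T (\<integral>x. indicator B x * \<phi> x \<partial>\<nu>)"
        using integral_shift_invariant[OF \<phi> shift_nu cyl B'] by simp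
      also have "\<dots> = (\<integral>x. indicator B x * T (\<phi> x) \<partial>\<nu>)"
        using integral_bounded_linear[OF T int[OF measurable_ident_sets[OF refl] B']] by (simp add: Tind)
      finally have "(\<integral>x. indicator B (shift x) * T (\<phi> x) \<partial>\<nu>) = (\<integral>x. indicator B x * T (\<phi> x) \<partial>\<nu>)" .
      moreover have "(\<lambda>x. indicator B (shift x) :: real) \<in> borel_measurable \<mu>"
        using shift_mu(1) B by measurable
      moreover have "(\<lambda>x. indicator B x :: real) \<in> borel_measurable \<mu>"
        using B by measurable
      ultimately show "(\<integral>x. indicator B (shift x) * (k x * T (\<phi> x)) \<partial>\<mu>)
          = (\<integral>x. indicator B x * (k x * T (\<phi> x)) \<partial>\<mu>)"
        by (simp add: transport)
    qed
    also have "(\<integral>x. k x * T (\<phi> x) \<partial>\<mu>) = (\<integral>x. T (\<phi> x) \<partial>\<nu>)"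
      using transport[of "\<lambda>_. 1"] by simp
    also have "\<dots> = T (\<integral>x. \<phi> x \<partial>\<nu>)"
      by (rule integral_bounded_linear[OF T \<phi>])
    finally show ?thesis .
  qed
  \<comment> \<open>ergodicity applies to real densities, hence to the real and the imaginary part\<close>
  show ?thesis
    using real_case[OF bounded_linear_Re] real_case[OF bounded_linear_Im]
    by eventually_elim (auto simp: complex_eq_iff)
qed

text \<open>
  Both \<open>f \<nu>\<close> and \<open>h \<nu>\<close> are invariant, so their densities with respect to the ergodic measure
  \<open>\<mu>\<close> are constant. Thus \<open>f\<close> is a multiple of \<open>h\<close>, and \<open>\<mu> = h \<nu>\<close>.
\<close>

lemma invariant_function:
  assumes f: "f \<in> X" and h: "h \<in> X" and h_norm: "(\<integral>x. h x \<partial>\<nu>) = 1"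
    and inv_f: "\<And>w. (\<integral>x. indicator (cylinder E w) (shift x) * f x \<partial>\<nu>)
      = (\<integral>x. indicator (cylinder E w) x * f x \<partial>\<nu>)"
    and inv_h: "\<And>w. (\<integral>x. indicator (cylinder E w) (shift x) * h x \<partial>\<nu>)
      = (\<integral>x. indicator (cylinder E w) x * h x \<partial>\<nu>)"
    and \<xi>: "integrable \<mu> \<xi>"
  shows "x \<in> E \<Longrightarrow> f x = (\<integral>x. f x \<partial>\<nu>) * h x"
    and "(\<integral>x. complex_of_real (\<xi> x) * f x \<partial>\<nu>) = (\<integral>x. f x \<partial>\<nu>) * complex_of_real (\<integral>x. \<xi> x \<partial>\<mu>)"
proof -
  obtain k where k: "k \<in> borel_measurable \<mu>" "\<And>x. 0 \<le> k x" "\<nu> = density \<mu> (\<lambda>x. ennreal (k x))"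
    using density_nu by blast
  note AE_f = AE_density_times_invariant[OF k X_integrable[OF f] inv_f]
  note AE_h = AE_density_times_invariant[OF k X_integrable[OF h] inv_h]
  have "AE x in \<mu>. f x = (\<integral>x. f x \<partial>\<nu>) * h x"
    using AE_f AE_h
  proof eventually_elim
    case (elim x)
    then have "complex_of_real (k x) * f x = complex_of_real (k x) * ((\<integral>x. f x \<partial>\<nu>) * h x)"
      using h_norm by (simp add: algebra_simps)
    moreover have "k x \<noteq> 0" using elim h_norm by auto
    ultimately show ?case by simp
  qed
  then show "x \<in> E \<Longrightarrow> f x = (\<integral>x. f x \<partial>\<nu>) * h x"
    by (rule eq_of_AE_eq[OF f bdd_scale[OF h]])
  have f_mu: "f \<in> borel_measurable \<mu>"
    using X_measurable[OF f] measurable_cong_sets[OF sets_mu refl] by blast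
  have \<xi>_mu: "\<xi> \<in> borel_measurable \<mu>" by (rule borel_measurable_integrable[OF \<xi>])
  have meas: "(\<lambda>x. complex_of_real (\<xi> x) * f x) \<in> borel_measurable \<mu>"
    using f_mu \<xi>_mu by measurable
  have "(\<integral>x. complex_of_real (\<xi> x) * f x \<partial>\<nu>)
      = (\<integral>x. k x *\<^sub>R (complex_of_real (\<xi> x) * f x) \<partial>\<mu>)"
    unfolding k(3) using k meas by (subst integral_density) auto
  also have "\<dots> = (\<integral>x. (\<integral>x. f x \<partial>\<nu>) * complex_of_real (\<xi> x) \<partial>\<mu>)"
  proof (rule integral_cong_AE)
    show "AE x in \<mu>. k x *\<^sub>R (complex_of_real (\<xi> x) * f x) = (\<integral>x. f x \<partial>\<nu>) * complex_of_real (\<xi> x)"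
      using AE_f by eventually_elim (simp add: scaleR_conv_of_real mult_ac)
    show "(\<lambda>x. k x *\<^sub>R (complex_of_real (\<xi> x) * f x)) \<in> borel_measurable \<mu>"
      by (intro borel_measurable_scaleR k(1) meas)
    show "(\<lambda>x. (\<integral>x. f x \<partial>\<nu>) * complex_of_real (\<xi> x)) \<in> borel_measurable \<mu>"
      using \<xi>_mu by measurable
  qed
  finally show "(\<integral>x. complex_of_real (\<xi> x) * f x \<partial>\<nu>) = (\<integral>x. f x \<partial>\<nu>) * complex_of_real (\<integral>x. \<xi> x \<partial>\<mu>)"
    by simp
qed

end

section \<open>The residue of the resolvent\<close>

lemma summable_potential_bounded_above:
  assumes E: "E = shift_space I A" and "summable_potential I E v"
  obtains S where "\<And>y. y \<in> E \<Longrightarrow> v y \<le> S"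
proof -
  let ?e = "\<lambda>e. exp_ereal (SUP \<tau>\<in>cylinder E [e]. ereal (v \<tau>))"
  have fin: "(\<Sum>\<^sub>\<infinity>e\<in>I. ?e e) < \<infinity>"
    using assms by (simp add: summable_potential_def)
  have "v y \<le> enn2real (\<Sum>\<^sub>\<infinity>e\<in>I. ?e e)" if y: "y \<in> E" for y
  proof -
    have "y 0 \<in> I" using y by (simp add: E shift_space_def)
    have "ereal (v y) \<le> (SUP \<tau>\<in>cylinder E [y 0]. ereal (v \<tau>))"
      using y by (intro SUP_upper) (simp add: mem_cylinder_iff)
    then have "ennreal (exp (v y)) \<le> ?e (y 0)"
      unfolding exp_ereal_def
      by (cases "SUP \<tau>\<in>cylinder E [y 0]. ereal (v \<tau>)") (auto intro: ennreal_leI)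
    also have "\<dots> = (\<Sum>\<^sub>\<infinity>e\<in>{y 0}. ?e e)" by simp
    also have "\<dots> \<le> (\<Sum>\<^sub>\<infinity>e\<in>I. ?e e)"
      using \<open>y 0 \<in> I\<close> by (intro infsum_mono_neutral nonneg_summable_on_complete) auto
    finally have "exp (v y) \<le> enn2real (\<Sum>\<^sub>\<infinity>e\<in>I. ?e e)"
      using fin enn2real_mono by (metis enn2real_ennreal exp_ge_zero infinity_ennreal_def)
    then show ?thesis using exp_ge_add_one_self[of "v y"] by linarith
  qed
  then show ?thesis using that by blast
qed

text \<open>
  \<open>\<xi>\<close> is, up to a factor, the difference of two potentials: the one at the pole is bounded
  above by summability, the one to its left has integrable negative part.
\<close>

lemma integrable_of_bounded_above:
  fixes u \<xi> :: "'a \<Rightarrow> real"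
  assumes "finite_measure M" and meas: "\<xi> \<in> borel_measurable M"
    and \<xi>: "\<And>y. y \<in> space M \<Longrightarrow> 0 \<le> \<xi> y" and u: "\<And>y. y \<in> space M \<Longrightarrow> u y \<le> S" and \<epsilon>: "0 < \<epsilon>"
    and fin: "(\<integral>\<^sup>+y. ennreal (- (u y - \<epsilon> * \<xi> y)) \<partial>M) < \<infinity>"
    and u_meas: "u \<in> borel_measurable M"
  shows "integrable M \<xi>"
proof -
  interpret finite_measure M by fact
  have "(\<integral>\<^sup>+y. ennreal (\<epsilon> * \<xi> y) \<partial>M) \<le> (\<integral>\<^sup>+y. ennreal (- (u y - \<epsilon> * \<xi> y)) + ennreal \<bar>S\<bar> \<partial>M)"
  proof (rule nn_integral_mono)
    fix y assume "y \<in> space M"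
    then have "\<epsilon> * \<xi> y \<le> max 0 (- (u y - \<epsilon> * \<xi> y)) + \<bar>S\<bar>" using u[of y] by linarith
    then have "ennreal (\<epsilon> * \<xi> y) \<le> ennreal (max 0 (- (u y - \<epsilon> * \<xi> y)) + \<bar>S\<bar>)"
      by (rule ennreal_leI)
    also have "\<dots> = ennreal (- (u y - \<epsilon> * \<xi> y)) + ennreal \<bar>S\<bar>"
      by (simp add: ennreal_plus max_def ennreal_neg)
    finally show "ennreal (\<epsilon> * \<xi> y) \<le> ennreal (- (u y - \<epsilon> * \<xi> y)) + ennreal \<bar>S\<bar>" .
  qed
  also have "\<dots> = (\<integral>\<^sup>+y. ennreal (- (u y - \<epsilon> * \<xi> y)) \<partial>M) + ennreal \<bar>S\<bar> * emeasure M (space M)"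
    using meas u_meas by (subst nn_integral_add) auto
  also have "\<dots> < \<infinity>"
    using fin emeasure_finite[of "space M"] by (simp add: ennreal_mult_eq_top_iff less_top[symmetric])
  finally have "integrable M (\<lambda>y. \<epsilon> * \<xi> y)"
    using meas \<xi> \<epsilon> by (intro integrableI_nonneg) auto
  then show ?thesis using \<epsilon> by simp
qed

theorem corollary2p17:
  fixes I :: "nat set" and A :: "nat \<Rightarrow> nat \<Rightarrow> bool" and E :: "(nat \<Rightarrow> nat) set"
    and \<theta> \<delta> :: real and \<eta> \<xi> chi h :: "(nat \<Rightarrow> nat) \<Rightarrow> real"
    and \<nu> \<mu> :: "(nat \<Rightarrow> nat) measure" and R :: "complex \<Rightarrow> operator" and x :: "nat \<Rightarrow> nat"
  assumes E: "E = shift_space I A"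
    and irreducible: "finitely_irreducible I A"
    and theta: "0 < \<theta>" "\<theta> < 1"
    and eta: "\<eta> \<in> holder_space E \<theta>"
    and xi: "\<xi> \<in> holder_space E \<theta>" "\<And>y. y \<in> E \<Longrightarrow> \<xi> y \<ge> 0"
    and delta: "pressure E (\<lambda>y. \<eta> y - \<delta> * \<xi> y) = 0"
    and delta_unique: "\<And>s. pressure E (\<lambda>y. \<eta> y - s * \<xi> y) = 0 \<Longrightarrow> s = \<delta>"
    and t_star: "ereal (- \<delta>) < (SUP t\<in>{t. summable_potential I E (\<lambda>y. \<eta> y + t * \<xi> y)}. ereal t)"
    and nu: "eigenmeasure E \<theta> (\<lambda>y. \<eta> y - \<delta> * \<xi> y) \<nu>"
    and h: "normalized_eigenfunction E \<theta> (\<lambda>y. \<eta> y - \<delta> * \<xi> y) \<nu> h"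
    and mu: "ergodic_gibbs_state E (\<lambda>y. \<eta> y - \<delta> * \<xi> y) \<mu>"
    and integral_finite: "\<exists>T. open T \<and> - \<delta> \<in> T \<and>
          (\<forall>t\<in>T. (\<integral>\<^sup>+y. ennreal (- (\<eta> y + t * \<xi> y)) \<partial>\<mu>) < \<infinity>)"
    and resolvent: "extended_resolvent E \<theta> \<eta> \<xi> (- \<delta>) R"
    and chi_bdd: "chi \<in> bdd_holder_space E \<theta>"
    and x: "x \<in> E"
  shows "residue (\<lambda>z. R z (\<lambda>y. complex_of_real (chi y)) x) (complex_of_real (- \<delta>))
    = complex_of_real (- ((\<integral>y. chi y \<partial>\<nu>) / (\<integral>y. \<xi> y \<partial>\<mu>)) * h x)"
proof -
  define u where "u = (\<lambda>y. \<eta> y - \<delta> * \<xi> y)"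
  define p where "p = complex_of_real (- \<delta>)"
  define V where "V = enn2real (holder_seminorm E \<theta> \<eta>) + \<bar>\<delta>\<bar> * enn2real (holder_seminorm E \<theta> \<xi>)"
  have V: "holder_bound E \<theta> u V" "0 \<le> V"
  proof -
    have \<eta>: "holder_bound E \<theta> \<eta> (enn2real (holder_seminorm E \<theta> \<eta>))"
      and \<xi>: "holder_bound E \<theta> \<xi> (enn2real (holder_seminorm E \<theta> \<xi>))"
      using eta xi(1) theta by (auto intro!: holder_bound_seminorm simp: holder_space_def)
    show "holder_bound E \<theta> u V"
      unfolding holder_bound_def
    proof (intro allI ballI impI)
      fix n y z assume *: "1 \<le> n" "y \<in> E" "z \<in> E" "\<forall>i<n. y i = z i"
      have "norm (u y - u z) = \<bar>(\<eta> y - \<eta> z) - \<delta> * (\<xi> y - \<xi> z)\<bar>"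
        by (simp add: u_def algebra_simps)
      also have "\<dots> \<le> \<bar>\<eta> y - \<eta> z\<bar> + \<bar>\<delta>\<bar> * \<bar>\<xi> y - \<xi> z\<bar>"
        using abs_triangle_ineq4[of "\<eta> y - \<eta> z" "\<delta> * (\<xi> y - \<xi> z)"] by (simp add: abs_mult)
      also have "\<dots> \<le> enn2real (holder_seminorm E \<theta> \<eta>) * \<theta> ^ n
          + \<bar>\<delta>\<bar> * (enn2real (holder_seminorm E \<theta> \<xi>) * \<theta> ^ n)"
        using holder_boundD[OF \<eta>, of n y z] holder_boundD[OF \<xi>, of n y z] *
        by (intro add_mono mult_left_mono) auto
      finally show "norm (u y - u z) \<le> V * \<theta> ^ n" by (simp add: V_def algebra_simps)
    qed
    show "0 \<le> V" by (simp add: V_def)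
  qed
  have P0: "pressure E u = 0" using delta by (simp add: u_def)
  have gibbs: "gibbs_state E u \<mu>" "shift_invariant \<mu>" "ergodic \<mu>"
    using mu by (auto simp: ergodic_gibbs_state_def u_def)
  interpret gibbs_pair E \<theta> I A u \<nu> \<mu> V
  proof (intro gibbs_pair.intro gibbs_pair_axioms.intro conformal_measure.intro
      conformal_measure_axioms.intro holder_exponent.intro)
    show "prob_space \<nu>" "sets \<nu> = sets (restrict_space borel E)"
      using nu by (auto simp: eigenmeasure_def borel_probability_def)
    show "(\<integral>x. transfer_operator E (\<lambda>y. complex_of_real (u y)) g x \<partial>\<nu>) = (\<integral>x. g x \<partial>\<nu>)"
      if "g \<in> bdd_holder_space E \<theta>" for g
      using nu that P0 by (simp add: eigenmeasure_def u_def)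
    show "prob_space \<mu>" "sets \<mu> = sets \<nu>"
      using gibbs(1) nu by (auto simp: gibbs_state_def eigenmeasure_def borel_probability_def)
    show "\<exists>c>0. \<forall>\<omega>\<in>E. \<forall>n.
      inverse c \<le> measure \<mu> (cylinder E (map \<omega> [0..<n])) / exp (birkhoff_sum n u \<omega>) \<and>
      measure \<mu> (cylinder E (map \<omega> [0..<n])) / exp (birkhoff_sum n u \<omega>) \<le> c"
      using gibbs(1) by (simp add: gibbs_state_def P0 Let_def)
    show "shift \<in> measurable \<mu> \<mu>" "distr \<mu> \<mu> shift = \<mu>"
      using gibbs(2) by (auto simp: shift_invariant_def)
    show "measure \<mu> B = 0 \<or> measure \<mu> B = 1" if "B \<in> sets \<mu>" "shift -` B \<inter> space \<mu> = B" for B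
      using gibbs(3) that by (auto simp: ergodic_def)
  qed (use E theta V in auto)

  have E_ne: "E \<noteq> {}" using x by blast
  define hc where "hc = (\<lambda>y. complex_of_real (h y))"
  have h': "h \<in> bdd_holder_space E \<theta>" "L hc = hc" "(\<integral>y. h y \<partial>\<nu>) = 1"
    using h P0 by (simp_all add: normalized_eigenfunction_def hc_def u_def)
  have hc: "hc \<in> X" "(\<integral>y. hc y \<partial>\<nu>) = 1" "L hc = hc"
    using bdd_of_real[OF h'(1)] h'(2,3) by (simp_all add: hc_def)
  have inv_h: "(\<integral>x. indicator (cylinder E w) (shift x) * hc x \<partial>\<nu>)
      = (\<integral>x. indicator (cylinder E w) x * hc x \<partial>\<nu>)" for w
    using integral_indicator_shift_eq[OF hc(1), of w] by (simp add: hc(3))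

  \<comment> \<open>some potential to the right of the pole is summable, and \<open>u\<close> lies below it\<close>
  have \<xi>_mu: "integrable \<mu> \<xi>"
  proof -
    obtain t where t: "- \<delta> < t" "summable_potential I E (\<lambda>y. \<eta> y + t * \<xi> y)"
      using t_star by (auto simp: less_SUP_iff)
    obtain S where S: "\<And>y. y \<in> E \<Longrightarrow> \<eta> y + t * \<xi> y \<le> S"
      by (rule summable_potential_bounded_above[OF E t(2)]) blast
    have u_le: "u y \<le> S" if "y \<in> E" for y
    proof -
      have "- \<delta> * \<xi> y \<le> t * \<xi> y" using t(1) xi(2)[OF that] by (intro mult_right_mono) auto
      then show ?thesis using S[OF that] by (simp add: u_def)
    qed
    obtain T where T: "open T" "- \<delta> \<in> T"
      and fin: "\<And>t. t \<in> T \<Longrightarrow> (\<integral>\<^sup>+y. ennreal (- (\<eta> y + t * \<xi> y)) \<partial>\<mu>) < \<infinity>"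
      using integral_finite by auto
    obtain e where e: "0 < e" "ball (- \<delta>) e \<subseteq> T"
      using T openE by blast
    then have "- \<delta> - e / 2 \<in> T" by (auto simp: dist_real_def)
    note fin = fin[OF this]
    have meas: "\<eta> \<in> borel_measurable \<mu>" "\<xi> \<in> borel_measurable \<mu>"
      using measurable_of_continuous_on eta xi(1) measurable_cong_sets[OF sets_mu refl]
      unfolding holder_space_def by blast+
    show ?thesis
    proof (rule integrable_of_bounded_above[where S = S and \<epsilon> = "e / 2" and u = u])
      show "(\<integral>\<^sup>+y. ennreal (- (u y - e / 2 * \<xi> y)) \<partial>\<mu>) < \<infinity>"
        using fin by (simp add: u_def algebra_simps)
      show "u \<in> borel_measurable \<mu>" unfolding u_def using meas by measurable
    qed (use meas e u_le xi(2) mu.finite_measure_axioms in \<open>auto simp: space_mu\<close>)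
  qed
  have \<xi>_nu: "integrable \<nu> \<xi>" by (rule integrable_nu_of_mu[OF \<xi>_mu])

  have inverse: "inverse_of_Id_minus E \<theta>
      (transfer_operator E (\<lambda>y. complex_of_real (\<eta> y) + z * complex_of_real (\<xi> y))) (R z)"
    if "Re z < - \<delta>" for z
    using resolvent that by (auto simp: extended_resolvent_def)
  obtain U H where U: "open U" "p \<in> U" and H: "operator_holomorphic_on E \<theta> H U"
    and R_H: "\<And>z g. z \<in> U - {p} \<Longrightarrow> g \<in> X \<Longrightarrow> R z g = (\<lambda>x. H z g x / (z - p))"
    using resolvent unfolding extended_resolvent_def operator_simple_pole_def p_def by blast
  have H_X: "H z g \<in> X" if "z \<in> U" "g \<in> X" for z g
    using H that by (auto simp: operator_holomorphic_on_def bounded_operators_def)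

  \<comment> \<open>the residue operator \<open>H p\<close> has rank one; its range is spanned by the eigenfunction\<close>
  have key: "(\<integral>y. H p g y \<partial>\<nu>) * complex_of_real (\<integral>y. \<xi> y \<partial>\<mu>) = - (\<integral>y. g y \<partial>\<nu>) \<and>
      H p g x = (\<integral>y. H p g y \<partial>\<nu>) * hc x" if g: "g \<in> X" for g
  proof -
    obtain D where D: "D \<in> X" "uniform_limit E (\<lambda>w y. (H w g y - H p g y) / (w - p)) D (at p)"
      using operator_holomorphic_imp_uniform_derivative[OF E_ne H U g] by blast
    obtain MD where MD: "\<And>y. norm (D y) \<le> MD" using D(1) by (elim bddE) blast
    obtain MH where MH: "\<And>y. norm (H p g y) \<le> MH" using H_X[OF U(2) g] by (elim bddE) blast
    have MD0: "0 \<le> MD" using MD norm_ge_zero order_trans by blast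
    have "\<forall>\<^sub>F w in at p. \<forall>y\<in>E. dist ((H w g y - H p g y) / (w - p)) (D y) < 1"
      using uniform_limitD[OF D(2), of 1] by simp
    moreover have "\<forall>\<^sub>F w in at p. w \<in> U"
      using U by (intro eventually_at_in_open') auto
    ultimately have "\<forall>\<^sub>F w in at p. w \<in> U \<and> (\<forall>y\<in>E. dist ((H w g y - H p g y) / (w - p)) (D y) < 1)"
      by eventually_elim simp
    then obtain e where e: "0 < e"
      and near: "\<And>w. w \<noteq> p \<Longrightarrow> dist w p < e \<Longrightarrow>
        w \<in> U \<and> (\<forall>y\<in>E. dist ((H w g y - H p g y) / (w - p)) (D y) < 1)"
      unfolding eventually_at by auto
    \<comment> \<open>approach the pole along the real axis from the left, where \<open>R\<close> is a genuine inverse\<close>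
    define a where "a n = e / real (n + 2)" for n
    define z where "z n = p - complex_of_real (a n)" for n
    have a: "0 < a n" "a n < e" for n
      using e by (auto simp: a_def divide_less_eq)
    have a_lim: "a \<longlonglongrightarrow> 0"
      unfolding a_def by (intro tendsto_divide_0[OF tendsto_const] filterlim_at_top_imp_at_infinity
          filterlim_compose[OF filterlim_real_sequentially] filterlim_add_const_nat_at_top)
    have z: "z n \<noteq> p" "dist (z n) p < e" "z n \<in> U" "Re (z n) < - \<delta>" for n
    proof -
      show "z n \<noteq> p" "dist (z n) p < e" "Re (z n) < - \<delta>"
        using a[of n] by (auto simp: z_def p_def dist_norm)
      then show "z n \<in> U" using near by blast
    qed
    have close: "norm (H (z n) g y - H p g y) \<le> a n * (MD + 1)" if "y \<in> E" for n y
    proof -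
      let ?q = "(H (z n) g y - H p g y) / (z n - p)"
      have "dist ?q (D y) < 1" using near[OF z(1,2)] that by blast
      then have "norm ?q \<le> MD + 1"
        using MD[of y] norm_triangle_sub[of ?q "D y"] by (simp add: dist_norm)
      moreover have "norm (H (z n) g y - H p g y) = norm ?q * a n"
        using a[of n] by (simp add: norm_divide z_def)
      ultimately show ?thesis using a[of n] by (simp add: mult.commute mult_left_mono)
    qed
    have F_conv: "(\<lambda>n. H (z n) g y) \<longlonglongrightarrow> H p g y" if "y \<in> E" for y
    proof -
      have "(\<lambda>n. a n * (MD + 1)) \<longlonglongrightarrow> 0" using tendsto_mult_right[OF a_lim, of "MD + 1"] by simp
      then have "(\<lambda>n. H (z n) g y - H p g y) \<longlonglongrightarrow> 0"
        by (rule Lim_null_comparison[rotated]) (simp add: close[OF that])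
      then show ?thesis by (simp add: LIM_zero_iff)
    qed
    have F_bound: "norm (H (z n) g y) \<le> MH + e * (MD + 1)" if "y \<in> E" for n y
    proof -
      have "norm (H (z n) g y) \<le> norm (H p g y) + norm (H (z n) g y - H p g y)"
        by (rule norm_triangle_sub)
      also have "\<dots> \<le> MH + a n * (MD + 1)" by (intro add_mono MH close that)
      also have "\<dots> \<le> MH + e * (MD + 1)"
        using a[of n] MD0 by (intro add_left_mono mult_right_mono) auto
      finally show ?thesis .
    qed
    let ?W = "\<lambda>n y. if y \<in> E then complex_of_real (exp (- (a n * \<xi> y))) else 0"
    have eq: "L (\<lambda>y. ?W n y * H (z n) g y) = (\<lambda>y. H (z n) g y + complex_of_real (a n) * g y)" for n
    proof -
      let ?Lz = "transfer_operator E (\<lambda>y. complex_of_real (\<eta> y) + z n * complex_of_real (\<xi> y))"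
      let ?r = "R (z n) g"
      \<comment> \<open>\<open>H z\<close> is \<open>(z - p) * R z\<close>, and \<open>z n - p\<close> is \<open>- a n\<close>\<close>
      have H_r: "H (z n) g = (\<lambda>y. - complex_of_real (a n) * ?r y)"
        using R_H[of "z n" g] z(1,3)[of n] g a[of n] by (simp add: z_def)
      have r: "(\<lambda>y. ?r y - ?Lz ?r y) = g"
        using inverse[OF z(4)] g by (auto simp: inverse_of_Id_minus_def)
      have "?Lz ?r y = ?r y - g y" for y using fun_cong[OF r, of y] by (simp add: algebra_simps)
      then have "?Lz (H (z n) g) = (\<lambda>y. - complex_of_real (a n) * (?r y - g y))"
        unfolding H_r
        using transfer_operator_mult_shift[of E _ "\<lambda>_. - complex_of_real (a n)" ?r] by simp
      also have "\<dots> = (\<lambda>y. H (z n) g y + complex_of_real (a n) * g y)"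
        by (simp add: H_r algebra_simps)
      \<comment> \<open>moving the parameter by \<open>- a n\<close> amounts to inserting a weight, bounded because \<open>\<xi>\<close> is nonnegative\<close>
      also have "?Lz (H (z n) g) = L (\<lambda>y. ?W n y * H (z n) g y)"
      proof (rule transfer_operator_weight)
        fix y assume "y \<in> E"
        have "complex_of_real (\<eta> y) + z n * complex_of_real (\<xi> y)
            = complex_of_real (u y) + complex_of_real (- (a n * \<xi> y))"
          by (simp add: z_def p_def u_def algebra_simps)
        then show "exp (complex_of_real (\<eta> y) + z n * complex_of_real (\<xi> y))
            = exp (complex_of_real (u y)) * ?W n y"
          using \<open>y \<in> E\<close> by (simp only: exp_add exp_of_real if_True)
      qed
      finally show ?thesis .
    qed
    have limit: "(\<integral>x. indicator (cylinder E w) (shift x) * H p g x \<partial>\<nu>)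
        = (\<integral>x. indicator (cylinder E w) x * H p g x \<partial>\<nu>)"
      "(\<integral>x. complex_of_real (\<xi> x) * H p g x \<partial>\<nu>) = - (\<integral>x. g x \<partial>\<nu>)" for w
      by (rule resolvent_limit[where a = a and \<xi> = \<xi> and g = g and F = "\<lambda>n. H (z n) g"
            and M = "MH + e * (MD + 1)"];
          (rule xi \<xi>_nu a(1) a_lim g H_X z(3) U(2) F_conv F_bound eq | assumption)+)+
    note inv = invariant_function[OF H_X[OF U(2) g] hc(1,2) limit(1) inv_h \<xi>_mu]
    show ?thesis using inv(1)[OF x] inv(2) limit(2) by simp
  qed

  \<comment> \<open>the constant function 1 shows that the denominator does not vanish\<close>
  have \<xi>_nz: "(\<integral>y. \<xi> y \<partial>\<mu>) \<noteq> 0"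
  proof
    assume "(\<integral>y. \<xi> y \<partial>\<mu>) = 0"
    then have "(\<integral>y. indicator (cylinder E []) y \<partial>\<nu>) = (0::complex)"
      using key[OF indicator_cylinder_bdd[of "[]"]] by simp
    moreover have "cylinder E [] = space \<nu>" by (auto simp: cylinder_def space_nu)
    ultimately show False
      using integral_complex_indicator[OF sets.top] by (simp add: nu.prob_space)
  qed

  let ?chi = "\<lambda>y. complex_of_real (chi y)"
  have chi: "?chi \<in> X" by (rule bdd_of_real[OF chi_bdd])
  have holo: "(\<lambda>z. H z ?chi x) holomorphic_on U"
    unfolding holomorphic_on_def
  proof
    fix z assume z: "z \<in> U"
    obtain D where "uniform_limit E (\<lambda>w y. (H w ?chi y - H z ?chi y) / (w - z)) D (at z)"
      using operator_holomorphic_imp_uniform_derivative[OF E_ne H U(1) z chi] by blast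
    from tendsto_uniform_limitI[OF this x]
    have "((\<lambda>z. H z ?chi x) has_field_derivative D x) (at z)"
      by (simp add: has_field_derivative_iff)
    then show "(\<lambda>z. H z ?chi x) field_differentiable at z within U"
      using field_differentiable_at_within field_differentiable_def by blast
  qed
  have "residue (\<lambda>z. R z ?chi x) p = residue (\<lambda>z. H z ?chi x / (z - p)) p"
  proof (rule residue_cong)
    have "\<forall>\<^sub>F z in at p. z \<in> U - {p}"
      using U by (intro eventually_at_in_open) auto
    then show "\<forall>\<^sub>F z in at p. R z ?chi x = H z ?chi x / (z - p)"
      by eventually_elim (simp add: R_H chi)
  qed simp
  also have "\<dots> = H p ?chi x"
    by (rule residue_simple[OF U holo])
  also have "\<dots> = - (\<integral>y. ?chi y \<partial>\<nu>) / complex_of_real (\<integral>y. \<xi> y \<partial>\<mu>) * hc x"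
    using key[OF chi] \<xi>_nz by (metis nonzero_eq_divide_eq of_real_eq_0_iff)
  finally show ?thesis
    by (simp add: p_def hc_def)
qed

end
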